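(* Let $m\ge 1$ be an integer, let $\mathcal H$ be a complex Hilbert space and let $A:D(A)\to\mathcal H$, $D(A)\subseteq\mathcal H$, be a linear operator. Then $A$ is the generator of an $m$-isometric semigroup $(T_t)_{t\ge 0}$ on $\mathcal H$ if and only if the following conditions are satisfied: (i) $A$ is closed and densely defined. (ii) There exists $w\ge 0$ such that $$\operatorname{Re}\langle Ay,y\rangle\le w\|y\|^2,\quad y\in D(A). \qquad ( * )$$ (iii) There exists $\lambda>w$ such that $\lambda-A:D(A)\to\mathcal H$ is surjective. (iv) $A$ is $m$-skew-symmetric. If conditions (i)–(iv) hold, and if $w\ge 0$, then $( * )$ is satisfied (with this $w$) if and only if $(T_t)_{t\ge 0}$ is quasicontractive with parameter $w$. Moreover, if conditions (i)–(iv) hold and $\lambda>0$, then $\lambda-A:D(A)\to\mathcal H$ is invertible.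
   Context: In (iii), $w$ is the constant from (ii). A bounded operator $T$ on $\mathcal H$ is $m$-isometric if $\sum_{k=0}^m(-1)^{m-k}\binom mk\|T^kx\|^2=0$ for all $x\in\mathcal H$. An $m$-isometric semigroup is a $C_0$-semigroup (strongly continuous one-parameter semigroup of bounded operators) $(T_t)_{t\ge0}$ such that each $T_t$ is $m$-isometric. Its generator is $Ay=\lim_{t\to0^+}(T_ty-y)/t$, with domain the set of $y\in\mathcal H$ for which the limit exists. An operator $A$ is $m$-skew-symmetric if $\sum_{k=0}^m\binom mk\langle A^ky,A^{m-k}y\rangle=0$ for all $y\in D(A^m)$. A $C_0$-semigroup $(T_t)_{t\ge0}$ is quasicontractive with parameter $w$ if $\|T_t\|\le e^{wt}$ for all $t\ge0$. *)

theory Defs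
  imports "HOL-Analysis.Analysis"
begin

text \<open>Complex Hilbert spaces. The inner product is linear in the first and conjugate-linear in the
  second argument. Positive definiteness is contained in \<open>cinner_self\<close>, since \<^const>\<open>norm\<close> is a norm;
  completeness is the superclass \<^class>\<open>banach\<close>.\<close>

class complex_hilbert_space = banach +
  fixes scaleC :: "complex \<Rightarrow> 'a \<Rightarrow> 'a" (infixr \<open>*\<^sub>C\<close> 75)
    and cinner :: "'a \<Rightarrow> 'a \<Rightarrow> complex"
  assumes scaleC_add_right: "c *\<^sub>C (x + y) = c *\<^sub>C x + c *\<^sub>C y"
    and scaleC_add_left: "(c + d) *\<^sub>C x = c *\<^sub>C x + d *\<^sub>C x"
    and scaleC_scaleC: "c *\<^sub>C (d *\<^sub>C x) = (c * d) *\<^sub>C x"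
    and scaleC_one: "1 *\<^sub>C x = x"
    and scaleR_scaleC: "r *\<^sub>R x = complex_of_real r *\<^sub>C x"
    and cinner_commute: "cinner x y = cnj (cinner y x)"
    and cinner_add_left: "cinner (x + y) z = cinner x z + cinner y z"
    and cinner_scaleC_left: "cinner (c *\<^sub>C x) y = c * cinner x y"
    and cinner_self: "cinner x x = complex_of_real ((norm x)\<^sup>2)"

instantiation complex :: complex_hilbert_space
begin

definition scaleC_complex :: "complex \<Rightarrow> complex \<Rightarrow> complex" where
  "scaleC_complex c x = c * x"

definition cinner_complex :: "complex \<Rightarrow> complex \<Rightarrow> complex" where
  "cinner_complex x y = x * cnj y"

instance
  by standard
    (simp_all add: scaleC_complex_def cinner_complex_def algebra_simps scaleR_conv_of_real
      complex_norm_square del: of_real_power)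

end

definition bounded_operator :: "('a::complex_hilbert_space \<Rightarrow> 'a) \<Rightarrow> bool" where
  "bounded_operator S \<longleftrightarrow> bounded_linear S \<and> (\<forall>c x. S (c *\<^sub>C x) = c *\<^sub>C S x)"

text \<open>An unbounded operator is a pair of a domain \<open>D\<close> and a total function \<open>A\<close>, whose values outside
  \<open>D\<close> are arbitrary and are never used below.\<close>

definition linear_operator ::
  "'a::complex_hilbert_space set \<Rightarrow> ('a \<Rightarrow> 'a) \<Rightarrow> bool" where
  "linear_operator D A \<longleftrightarrow>
     0 \<in> D \<and>
     (\<forall>x\<in>D. \<forall>y\<in>D. x + y \<in> D \<and> A (x + y) = A x + A y) \<and>
     (\<forall>c. \<forall>x\<in>D. c *\<^sub>C x \<in> D \<and> A (c *\<^sub>C x) = c *\<^sub>C A x)"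

definition closed_operator ::
  "'a::complex_hilbert_space set \<Rightarrow> ('a \<Rightarrow> 'a) \<Rightarrow> bool" where
  "closed_operator D A \<longleftrightarrow> closed {(y, A y) | y. y \<in> D}"

definition densely_defined :: "'a::complex_hilbert_space set \<Rightarrow> bool" where
  "densely_defined D \<longleftrightarrow> closure D = UNIV"

text \<open>The domain of the \<open>n\<close>-th power; on it the power is \<open>A ^^ n\<close>.\<close>

primrec power_domain ::
  "'a::complex_hilbert_space set \<Rightarrow> ('a \<Rightarrow> 'a) \<Rightarrow> nat \<Rightarrow> 'a set" where
  "power_domain D A 0 = UNIV"
| "power_domain D A (Suc n) = {y \<in> D. A y \<in> power_domain D A n}"

definition m_skew_symmetric ::
  "nat \<Rightarrow> 'a::complex_hilbert_space set \<Rightarrow> ('a \<Rightarrow> 'a) \<Rightarrow> bool" where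
  "m_skew_symmetric m D A \<longleftrightarrow>
     (\<forall>y \<in> power_domain D A m.
        (\<Sum>k\<le>m. of_nat (m choose k) * cinner ((A ^^ k) y) ((A ^^ (m - k)) y)) = 0)"

definition numerical_bound ::
  "real \<Rightarrow> 'a::complex_hilbert_space set \<Rightarrow> ('a \<Rightarrow> 'a) \<Rightarrow> bool" where
  "numerical_bound w D A \<longleftrightarrow> (\<forall>y\<in>D. Re (cinner (A y) y) \<le> w * (norm y)\<^sup>2)"

text \<open>Invertibility of an unbounded operator in the operator-theoretic sense: it maps its domain
  bijectively onto the whole space, with bounded inverse.\<close>

definition invertible_operator ::
  "'a::complex_hilbert_space set \<Rightarrow> ('a \<Rightarrow> 'a) \<Rightarrow> bool" where
  "invertible_operator D B \<longleftrightarrow>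
     (\<exists>R. bounded_operator R \<and> (\<forall>x. R x \<in> D \<and> B (R x) = x) \<and> (\<forall>y\<in>D. R (B y) = y))"

definition m_isometric :: "nat \<Rightarrow> ('a::complex_hilbert_space \<Rightarrow> 'a) \<Rightarrow> bool" where
  "m_isometric m S \<longleftrightarrow> bounded_operator S \<and>
     (\<forall>x. (\<Sum>k\<le>m. (-1) ^ (m - k) * real (m choose k) * (norm ((S ^^ k) x))\<^sup>2) = 0)"

text \<open>Semigroups are functions on the reals; only their values at nonnegative times matter.\<close>

definition C0_semigroup :: "(real \<Rightarrow> 'a::complex_hilbert_space \<Rightarrow> 'a) \<Rightarrow> bool" where
  "C0_semigroup T \<longleftrightarrow>
     (\<forall>t\<ge>0. bounded_operator (T t)) \<and>
     T 0 = id \<and>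
     (\<forall>s\<ge>0. \<forall>t\<ge>0. T (s + t) = T s \<circ> T t) \<and>
     (\<forall>x. continuous_on {0..} (\<lambda>t. T t x))"

definition m_isometric_semigroup ::
  "nat \<Rightarrow> (real \<Rightarrow> 'a::complex_hilbert_space \<Rightarrow> 'a) \<Rightarrow> bool" where
  "m_isometric_semigroup m T \<longleftrightarrow> C0_semigroup T \<and> (\<forall>t\<ge>0. m_isometric m (T t))"

definition quasicontractive :: "real \<Rightarrow> (real \<Rightarrow> 'a::complex_hilbert_space \<Rightarrow> 'a) \<Rightarrow> bool" where
  "quasicontractive w T \<longleftrightarrow> C0_semigroup T \<and> (\<forall>t\<ge>0. onorm (T t) \<le> exp (w * t))"

definition is_generator ::
  "(real \<Rightarrow> 'a::complex_hilbert_space \<Rightarrow> 'a) \<Rightarrow> 'a set \<Rightarrow> ('a \<Rightarrow> 'a) \<Rightarrow> bool" where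
  "is_generator T D A \<longleftrightarrow>
     D = {y. \<exists>l. ((\<lambda>t. (T t y - y) /\<^sub>R t) \<longlongrightarrow> l) (at_right 0)} \<and>
     (\<forall>y\<in>D. ((\<lambda>t. (T t y - y) /\<^sub>R t) \<longlongrightarrow> A y) (at_right 0))"

text \<open>The conjunction of (i) to (iv). The existential quantifier of (ii) extends over (iii), which
  refers to the same \<open>w\<close>; \<open>\<mu>\<close> is the real number called lambda there.\<close>

definition generation_conditions ::
  "nat \<Rightarrow> 'a::complex_hilbert_space set \<Rightarrow> ('a \<Rightarrow> 'a) \<Rightarrow> bool" where
  "generation_conditions m D A \<longleftrightarrow>
     closed_operator D A \<and> densely_defined D \<and>
     (\<exists>w\<ge>0. numerical_bound w D A \<and>
        (\<exists>\<mu>>w. (\<lambda>y. \<mu> *\<^sub>R y - A y) ` D = UNIV)) \<and>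
     m_skew_symmetric m D A"

end

(* Every orbit of an m-isometric semigroup has a squared norm that is a polynomial of degree < m in
   time (Frechet's theorem on vanishing differences), with coefficients that are bounded quadratic
   forms in the initial vector. Its derivative at 0 is 2 Re <Ay, y>, which gives (ii); its m-th
   derivative is the sum in (iv), so that (iv) says exactly that the m-th differences vanish; and
   polynomial growth makes exp (- l N) T_N a strict contraction for some N, which gives a bounded
   inverse of l - A for every l > 0.

   Conversely, A - w is dissipative, and its contraction semigroup is the limit of the backward Euler
   schemes (1 - h A)^(-n) with n h = t along the step sizes h = 2^(-k). Halving the step changes the
   result on D(A^2) by O(t h), so the limit exists without exponentials of Yosida approximations. *)

theory Submission
  imports Defs
begin

text \<open>The obstacle in (ii): growth like M exp (w t) with M > 1, which every C0-semigroup has,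
  gives no upper bound for Re <Ay, y>. The orbit polynomials do, because their coefficients are
  bounded forms. That boundedness costs little: Newton interpolation at integer times expresses the
  coefficients through the finitely many operators T_0, ..., T_(m-1). The same formula bounds the
  semigroup on compact time intervals. For (iv) a mean value theorem for m-th differences serves
  both directions: on D(A^m) an m-th difference with step h is h^m times the skew sum at an
  intermediate time. Letting h tend to 0 gives (iv); conversely (iv) annihilates the difference for
  every h > 0, and density of D(A^m) extends this to all vectors. In the Euler schemes t has to be
  rounded to a multiple of the step. Step counts are therefore neither additive in t nor exactly
  doubled by halving the step, but they are off by at most one step, and one step of size h moves a
  vector y of D by at most h norm (A y).\<close>

section \<open>Complex Hilbert spaces\<close>

lemma cinner_add_right: "cinner x (y + z) = cinner x y + cinner x (z::'a::complex_hilbert_space)"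
  by (metis cinner_add_left cinner_commute complex_cnj_add)

lemma cinner_scaleC_right: "cinner x (c *\<^sub>C y) = cnj c * cinner x (y::'a::complex_hilbert_space)"
  by (metis cinner_commute cinner_scaleC_left complex_cnj_mult)

lemma Re_cinner_self: "Re (cinner x x) = (norm x)\<^sup>2"
  by (simp add: cinner_self)

lemma Re_cinner_commute: "Re (cinner x y) = Re (cinner y x)"
  by (metis cinner_commute complex_cnj cnj.sel(1))

lemma norm_scaleC: "norm (c *\<^sub>C x) = cmod c * norm (x::'a::complex_hilbert_space)"
proof -
  have "cinner (c *\<^sub>C x) (c *\<^sub>C x) = (c * cnj c) * cinner x x"
    by (simp add: cinner_scaleC_left cinner_scaleC_right)
  then have "complex_of_real ((norm (c *\<^sub>C x))\<^sup>2) = complex_of_real ((cmod c * norm x)\<^sup>2)"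
    by (simp add: cinner_self complex_norm_square[symmetric] power_mult_distrib)
  then show ?thesis
    by (simp only: of_real_eq_iff) (simp add: power2_eq_imp_eq)
qed

lemma bounded_linear_scaleC: "bounded_linear (\<lambda>x::'a::complex_hilbert_space. c *\<^sub>C x)"
  by (rule bounded_linear_intro[where K="cmod c"])
    (simp_all add: scaleC_add_right scaleR_scaleC scaleC_scaleC mult.commute norm_scaleC)

text \<open>Cauchy--Schwarz comes for free: the norm is already known to satisfy the triangle inequality.\<close>

lemma Re_cinner_le: "Re (cinner x y) \<le> norm x * norm (y::'a::complex_hilbert_space)"
proof -
  have "(norm (x + y))\<^sup>2 = (norm x)\<^sup>2 + 2 * Re (cinner x y) + (norm y)\<^sup>2"
    using Re_cinner_commute[of x y]
    by (simp add: Re_cinner_self[symmetric] cinner_add_left cinner_add_right)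
  moreover have "(norm (x + y))\<^sup>2 \<le> (norm x + norm y)\<^sup>2"
    by (simp add: norm_triangle_ineq power_mono)
  ultimately show ?thesis
    by (simp add: power2_sum)
qed

text \<open>\<open>cinner\<close> is conjugate-linear in its second argument; its real part is
  bilinear over the reals, which opens the product rule and the limit theorems for bounded bilinear
  maps.\<close>

lemma bounded_bilinear_Re_cinner:
  "bounded_bilinear (\<lambda>x y::'a::complex_hilbert_space. Re (cinner x y))"
proof
  fix r :: real and a b :: 'a
  show "Re (cinner (r *\<^sub>R a) b) = r *\<^sub>R Re (cinner a b)" "Re (cinner a (r *\<^sub>R b)) = r *\<^sub>R Re (cinner a b)"
    by (simp_all add: scaleR_scaleC cinner_scaleC_left cinner_scaleC_right)
next
  \<comment> \<open>Replacing \<open>a\<close> by its negative makes the one-sided Cauchy-Schwarz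
    bound two-sided.\<close>
  have "norm (Re (cinner a b)) \<le> norm a * norm b * 1" for a b :: 'a
    using Re_cinner_le[of a b] Re_cinner_le[of "(-1) *\<^sub>C a" b]
    by (auto simp: cinner_scaleC_left norm_scaleC)
  then show "\<exists>K. \<forall>a b::'a. norm (Re (cinner a b)) \<le> norm a * norm b * K"
    by blast
qed (simp_all add: cinner_add_left cinner_add_right)

lemmas Re_cinner_simps =
  bounded_bilinear.diff_left[OF bounded_bilinear_Re_cinner]
  bounded_bilinear.scaleR_left[OF bounded_bilinear_Re_cinner]
  bounded_bilinear.add_left[OF bounded_bilinear_Re_cinner]

section \<open>Linear operators\<close>

lemma linear_operator_simps:
  assumes "linear_operator D A"
  shows "0 \<in> D" "x \<in> D \<Longrightarrow> y \<in> D \<Longrightarrow> x + y \<in> D"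
    "x \<in> D \<Longrightarrow> y \<in> D \<Longrightarrow> A (x + y) = A x + A y"
    "x \<in> D \<Longrightarrow> c *\<^sub>C x \<in> D" "x \<in> D \<Longrightarrow> A (c *\<^sub>C x) = c *\<^sub>C A x"
    "x \<in> D \<Longrightarrow> r *\<^sub>R x \<in> D" "x \<in> D \<Longrightarrow> A (r *\<^sub>R x) = r *\<^sub>R A x"
    "x \<in> D \<Longrightarrow> y \<in> D \<Longrightarrow> x - y \<in> D"
    "x \<in> D \<Longrightarrow> y \<in> D \<Longrightarrow> A (x - y) = A x - A y"
proof -
  show a: "x + y \<in> D" "A (x + y) = A x + A y" if "x \<in> D" "y \<in> D" for x y
    using assms that unfolding linear_operator_def by blast+
  show c: "c *\<^sub>C x \<in> D" "A (c *\<^sub>C x) = c *\<^sub>C A x" if "x \<in> D" for c x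
    using assms that unfolding linear_operator_def by blast+
  show "0 \<in> D"
    using assms unfolding linear_operator_def by blast
  show r: "r *\<^sub>R x \<in> D" "A (r *\<^sub>R x) = r *\<^sub>R A x" if "x \<in> D" for r x
    using c[OF that] by (simp_all add: scaleR_scaleC)
  have m: "- x \<in> D" "A (- x) = - A x" if "x \<in> D" for x
    using r[OF that, of "-1"] by simp_all
  show "x - y \<in> D" "A (x - y) = A x - A y" if "x \<in> D" "y \<in> D"
    using a[OF that(1) m(1)[OF that(2)]] m(2)[OF that(2)] by simp_all
qed

lemma linear_operator_scaleR_diff:
  assumes "linear_operator D A"
  shows "linear_operator D (\<lambda>y. a *\<^sub>R y - b *\<^sub>R A y)"
  using assms unfolding linear_operator_def
  by (auto simp: algebra_simps scaleR_scaleC scaleC_scaleC scaleC_add_right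
      bounded_linear.linear[OF bounded_linear_scaleC, THEN linear_diff])

text \<open>The lower estimate does double duty: it makes \<open>B\<close> injective and bounds the
  inverse by \<open>C\<close>. Every inverse below is obtained in this way.\<close>

lemma invertible_operatorI:
  assumes lin: "linear_operator D B" and lower: "\<And>y. y \<in> D \<Longrightarrow> norm y \<le> C * norm (B y)"
    and surj: "B ` D = UNIV"
  shows "invertible_operator D B"
proof -
  note L = linear_operator_simps[OF lin]
  have inj: "y = z" if "y \<in> D" "z \<in> D" "B y = B z" for y z
    using lower[of "y - z"] that L(8,9)[of y z] by simp
  define R where "R = inv_into D B"
  have RD: "R x \<in> D" and BR: "B (R x) = x" for x
    unfolding R_def using surj by (auto intro!: inv_into_into f_inv_into_f)
  have scale: "R (c *\<^sub>C x) = c *\<^sub>C R x" for c x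
    by (rule inj) (simp_all add: RD BR L)
  have "bounded_linear R"
  proof (rule bounded_linear_intro)
    show "R (x + y) = R x + R y" for x y
      by (rule inj) (simp_all add: RD BR L)
    show "R (r *\<^sub>R x) = r *\<^sub>R R x" for r x
      by (simp add: scaleR_scaleC scale)
    show "norm (R x) \<le> norm x * C" for x
      using lower[OF RD[of x]] by (simp add: BR mult.commute)
  qed
  then have "bounded_operator R"
    by (simp add: bounded_operator_def scale)
  moreover have "R (B y) = y" if "y \<in> D" for y
    by (rule inj) (simp_all add: RD BR that)
  ultimately show ?thesis
    unfolding invertible_operator_def using RD BR by blast
qed

text \<open>The solution is the fixed point of the contraction z -> x + S z, so Banach's theorem
  takes the place of a Neumann series.\<close>

lemma contraction_perturbation_surj:
  fixes S :: "'a::banach \<Rightarrow> 'a"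
  assumes "\<And>x y. S (x - y) = S x - S y" and "\<And>x. norm (S x) \<le> c * norm x" and "0 \<le> c" "c < 1"
  shows "\<exists>z. z - S z = x"
proof -
  have "\<exists>!z. x + S z = z"
    using assms(2-4) by (intro banach_fix_type[of c]) (auto simp: dist_norm assms(1)[symmetric])
  then obtain z where "x + S z = z" by blast
  then show ?thesis
    by (metis add_diff_cancel_right')
qed

lemma bounded_operator_funpow: "bounded_operator S \<Longrightarrow> bounded_operator (S ^^ n)"
proof (induction n)
  case 0
  then show ?case
    by (simp add: bounded_operator_def bounded_linear_ident id_def)
next
  case (Suc n)
  then show ?case
    by (auto simp: bounded_operator_def o_def intro: bounded_linear_compose)
qed

section \<open>Finite differences\<close>

text \<open>An operator on sequences, so that it can be iterated: the m-isometry sum of S at x is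
  \<open>fdiff ^^ m\<close>, at index 0, of the sequence of squared norms of S^k x.\<close>

definition fdiff :: "(nat \<Rightarrow> real) \<Rightarrow> nat \<Rightarrow> real" where
  "fdiff g k = g (Suc k) - g k"

text \<open>Pascal's rule under the sum. It drives the induction for iterated differences, Newton's
  formula and the Leibniz rule behind \<open>skew_orbit\<close>.\<close>

lemma sum_Suc_choose:
  fixes f :: "nat \<Rightarrow> real"
  shows "(\<Sum>k\<le>Suc n. real (Suc n choose k) * f k) =
    (\<Sum>k\<le>n. real (n choose k) * f k) + (\<Sum>k\<le>n. real (n choose k) * f (Suc k))"
proof -
  have "(\<Sum>k\<le>Suc n. real (Suc n choose k) * f k) =
      f 0 + (\<Sum>k\<le>n. real (n choose Suc k) * f (Suc k)) + (\<Sum>k\<le>n. real (n choose k) * f (Suc k))"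
    unfolding sum.atMost_Suc_shift by (simp add: algebra_simps sum.distrib)
  also have "f 0 + (\<Sum>k\<le>n. real (n choose Suc k) * f (Suc k)) = (\<Sum>k\<le>Suc n. real (n choose k) * f k)"
    unfolding sum.atMost_Suc_shift by simp
  finally show ?thesis
    by simp
qed

lemma fdiff_funpow_Suc: "(fdiff ^^ Suc n) g j = (fdiff ^^ n) g (Suc j) - (fdiff ^^ n) g j"
  unfolding funpow.simps o_apply by (rule fdiff_def)

lemma fdiff_funpow:
  "(fdiff ^^ n) g j = (\<Sum>k\<le>n. (-1) ^ (n - k) * real (n choose k) * g (j + k))"
proof (induction n arbitrary: j)
  case (Suc n)
  have "(\<Sum>k\<le>Suc n. (-1) ^ (Suc n - k) * real (Suc n choose k) * g (j + k)) =
      (\<Sum>k\<le>Suc n. real (Suc n choose k) * ((-1) ^ (Suc n - k) * g (j + k)))"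
    by (simp add: mult.assoc mult.left_commute)
  also have "\<dots> = (\<Sum>k\<le>n. real (n choose k) * ((-1) ^ (Suc n - k) * g (j + k)))
      + (\<Sum>k\<le>n. real (n choose k) * ((-1) ^ (n - k) * g (Suc j + k)))"
    unfolding sum_Suc_choose by simp
  also have "(\<Sum>k\<le>n. real (n choose k) * ((-1) ^ (Suc n - k) * g (j + k))) = - (fdiff ^^ n) g j"
    unfolding Suc.IH sum_negf[symmetric]
    by (rule sum.cong) (auto simp: Suc_diff_le)
  also have "(\<Sum>k\<le>n. real (n choose k) * ((-1) ^ (n - k) * g (Suc j + k))) = (fdiff ^^ n) g (Suc j)"
    unfolding Suc.IH by (simp add: mult.assoc mult.left_commute)
  finally show ?case
    unfolding fdiff_funpow_Suc by simp
qed simp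

text \<open>The shift by one is 1 + \<open>fdiff\<close>; its j-th power is expanded by the binomial
  theorem.\<close>

lemma Newton_forward_difference: "g j = (\<Sum>i\<le>j. real (j choose i) * (fdiff ^^ i) g 0)"
proof -
  have "g (s + j) = (\<Sum>i\<le>j. real (j choose i) * (fdiff ^^ i) g s)" for s
  \<comment> \<open>The sequence has to vary: the step uses the formula for \<open>g\<close> and for
    \<open>fdiff g\<close>.\<close>
  proof (induction j arbitrary: g)
    case (Suc j)
    have "g (s + Suc j) = g (s + j) + fdiff g (s + j)"
      by (simp add: fdiff_def)
    also have "\<dots> = (\<Sum>i\<le>Suc j. real (Suc j choose i) * (fdiff ^^ i) g s)"
      unfolding Suc.IH[of g] Suc.IH[of "fdiff g"] sum_Suc_choose by (simp add: funpow_swap1)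
    finally show ?case .
  qed simp
  from this[of 0] show ?thesis by simp
qed

lemma Newton_interpolation:
  assumes "\<And>j. (fdiff ^^ m) g j = 0"
  shows "g j = (\<Sum>i<m. (fdiff ^^ i) g 0 * (real j gchoose i))"
proof -
  have zero: "(fdiff ^^ i) g = (\<lambda>_. 0)" if "m \<le> i" for i
    using that by (induction i rule: dec_induct) (auto simp: assms fdiff_funpow_Suc simp del: funpow.simps)
  have "g j = (\<Sum>i\<in>{..j}. real (j choose i) * (fdiff ^^ i) g 0)"
    by (rule Newton_forward_difference)
  \<comment> \<open>The common range avoids a case distinction between j and m: terms with i > j
    vanish through \<open>j choose i\<close>, terms with i \<ge> m through the differences.\<close>
  also have "\<dots> = (\<Sum>i\<in>{..j} \<union> {..<m}. real (j choose i) * (fdiff ^^ i) g 0)"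
    by (rule sum.mono_neutral_left) auto
  also have "\<dots> = (\<Sum>i<m. real (j choose i) * (fdiff ^^ i) g 0)"
    by (rule sum.mono_neutral_right) (auto simp: zero)
  finally show ?thesis
    by (simp add: mult.commute binomial_gbinomial)
qed

text \<open>An m-fold mean value theorem, for derivatives that are one-sided at 0. Replacing F by
  its increments over h trades one difference for one increment of the m-th derivative; the ordinary
  mean value theorem then turns that increment into a further derivative.\<close>

lemma fdiff_mean_value:
  assumes "\<And>n t. n < m \<Longrightarrow> t \<ge> 0 \<Longrightarrow> (F n has_real_derivative F (Suc n) t) (at t within {0..})"
    and "h > 0" and "s \<ge> 0"
  shows "\<exists>\<xi>. s \<le> \<xi> \<and> \<xi> \<le> s + real m * h \<and>
    (fdiff ^^ m) (\<lambda>k. F 0 (s + real k * h)) 0 = h ^ m * F m \<xi>"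
  using assms(1)
proof (induction m arbitrary: F)
  case 0
  then show ?case by auto
next
  case (Suc m)
  define G where "G n t = F n (t + h) - F n t" for n t
  have shifted: "((\<lambda>t. F n (t + h)) has_real_derivative F (Suc n) (t + h)) (at t within {0..})"
    if "n < Suc m" "t \<ge> 0" for n t
  proof -
    have "(F n has_real_derivative F (Suc n) (t + h)) (at (t + h) within (\<lambda>t. t + h) ` {0..})"
      by (rule DERIV_subset[OF Suc.prems]) (use that \<open>h > 0\<close> in auto)
    then show ?thesis
      using DERIV_image_chain[of "F n" "F (Suc n) (t + h)" "\<lambda>t. t + h" t "{0..}" 1]
        DERIV_add[OF DERIV_ident DERIV_const, of h t "{0..}"]
      by (simp add: o_def)
  qed
  have "(G n has_real_derivative G (Suc n) t) (at t within {0..})" if "n < m" "t \<ge> 0" for n t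
    unfolding G_def using that by (intro DERIV_diff shifted Suc.prems) auto
  then obtain \<xi> where \<xi>: "s \<le> \<xi>" "\<xi> \<le> s + real m * h"
    "(fdiff ^^ m) (\<lambda>k. G 0 (s + real k * h)) 0 = h ^ m * G m \<xi>"
    using Suc.IH[of G] by auto
  have "\<exists>x\<in>{\<xi><..<\<xi> + h}. F m (\<xi> + h) - F m \<xi> = F (Suc m) x * (\<xi> + h - \<xi>)"
    using \<open>h > 0\<close> \<xi>(1) \<open>s \<ge> 0\<close>
    by (intro mvt_simple has_derivative_subset[OF Suc.prems[unfolded has_field_derivative_def]]) auto
  then obtain x where x: "\<xi> < x" "x < \<xi> + h" "G m \<xi> = h * F (Suc m) x"
    unfolding G_def by (auto simp: mult.commute)
  have "(fdiff ^^ Suc m) (\<lambda>k. F 0 (s + real k * h)) 0 =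
      (fdiff ^^ m) (\<lambda>k. G 0 (s + real k * h)) 0"
    unfolding funpow_Suc_right o_apply
    by (rule arg_cong[where f="\<lambda>g. (fdiff ^^ m) g 0"]) (auto simp: fdiff_def G_def algebra_simps)
  also have "\<dots> = h ^ Suc m * F (Suc m) x"
    by (simp add: \<xi>(3) x(3))
  finally show ?case
    using \<xi> x by (intro exI[of _ x]) (auto simp: algebra_simps)
qed

lemma gchoose_eq_poly: "\<exists>p. \<forall>x::real. x gchoose i = poly p x"
  by (rule exI[of _ "smult (1 / fact i) (\<Prod>k<i. [:- real k, 1:])"])
    (simp add: gbinomial_prod_rev poly_prod atLeast0LessThan)

lemma sum_gchoose_eq_poly: "\<exists>p. \<forall>x::real. (\<Sum>i<m. c i * (x gchoose i)) = poly p x"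
proof -
  obtain p where "\<And>i x::real. x gchoose i = poly (p i) x"
    using gchoose_eq_poly by metis
  then show ?thesis
    by (intro exI[of _ "\<Sum>i<m. smult (c i) (p i)"]) (simp add: poly_sum)
qed

text \<open>Frechet: on each grid \<open>\<nat> / n\<close> Newton interpolation gives a polynomial; all these polynomials
  agree with the one for \<open>n = 1\<close> at the natural numbers, hence everywhere.\<close>

lemma continuous_fdiff_zero_imp_polynomial:
  fixes f :: "real \<Rightarrow> real"
  assumes cont: "continuous_on {0..} f"
    and zero: "\<And>s h. s \<ge> 0 \<Longrightarrow> h \<ge> 0 \<Longrightarrow> (fdiff ^^ m) (\<lambda>k. f (s + real k * h)) 0 = 0"
    and "t \<ge> 0"
  shows "f t = (\<Sum>i<m. (fdiff ^^ i) (\<lambda>k. f (real k)) 0 * (t gchoose i))"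
proof -
  have grid: "f (real j * h) = (\<Sum>i<m. (fdiff ^^ i) (\<lambda>k. f (real k * h)) 0 * (real j gchoose i))"
    if "h \<ge> 0" for h j
  proof (rule Newton_interpolation)
    fix j
    have "(fdiff ^^ m) (\<lambda>k. f (real k * h)) j = (fdiff ^^ m) (\<lambda>k. f (real j * h + real k * h)) 0"
      by (simp add: fdiff_funpow algebra_simps)
    then show "(fdiff ^^ m) (\<lambda>k. f (real k * h)) j = 0"
      using zero that by simp
  qed
  obtain P where P: "\<And>x. (\<Sum>i<m. (fdiff ^^ i) (\<lambda>k. f (real k)) 0 * (x gchoose i)) = poly P x"
    using sum_gchoose_eq_poly by metis
  have frac: "f (real j / real n) = poly P (real j / real n)" if "n > 0" for j n
  proof -
    obtain Q where Q: "\<And>x. (\<Sum>i<m. (fdiff ^^ i) (\<lambda>k. f (real k * (1 / real n))) 0 * (x gchoose i)) = poly Q x"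
      using sum_gchoose_eq_poly by metis
    \<comment> \<open>The variable of \<open>Q\<close> is the index on the fine grid; composing with
      multiplication by n makes it time. A natural number k has index k n there, so the composition
      meets \<open>P\<close> at infinitely many points and equals it.\<close>
    have "poly (Q \<circ>\<^sub>p [:0, real n:]) (real k) = poly P (real k)" for k
      using grid[of "1 / real n" "k * n"] grid[of 1 k] that
      by (simp add: poly_pcompose Q[symmetric] P[symmetric] mult.commute)
    then have "range real \<subseteq> {x. poly (Q \<circ>\<^sub>p [:0, real n:] - P) x = 0}"
      by auto
    moreover have "infinite (range real)"
      by (simp add: range_inj_infinite)
    ultimately have "Q \<circ>\<^sub>p [:0, real n:] - P = 0"
      using poly_roots_finite infinite_super by blast
    then have "poly P (real j / real n) = poly (Q \<circ>\<^sub>p [:0, real n:]) (real j / real n)"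
      by simp
    also have "\<dots> = poly Q (real j)"
      using that by (simp add: poly_pcompose)
    finally show ?thesis
      using grid[of "1 / real n" j] by (simp add: Q[symmetric])
  qed
  \<comment> \<open>Grid points that approach t from below and stay in {0..}, where \<open>f\<close>
    is continuous.\<close>
  define r where "r n = real (nat \<lfloor>t * real (Suc n)\<rfloor>) / real (Suc n)" for n
  have r_bounds: "t - 1 / real (Suc n) \<le> r n" "r n \<le> t" "0 \<le> r n" for n
  proof -
    let ?N = "real (Suc n)"
    have eq: "r n = \<lfloor>t * ?N\<rfloor> / ?N"
      unfolding r_def using \<open>t \<ge> 0\<close> by (subst of_nat_nat) simp_all
    have "(t * ?N - 1) / ?N \<le> r n" "r n \<le> t * ?N / ?N"
      unfolding eq by (intro divide_right_mono; linarith)+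
    then show "t - 1 / ?N \<le> r n" "r n \<le> t" "0 \<le> r n"
      by (simp_all add: diff_divide_distrib r_def del: of_nat_Suc)
  qed
  have r: "r \<longlonglongrightarrow> t"
  proof (rule tendsto_sandwich)
    show "(\<lambda>n. t - 1 / real (Suc n)) \<longlonglongrightarrow> t"
      using tendsto_diff[OF tendsto_const LIMSEQ_inverse_real_of_nat, of t] by (simp add: divide_inverse)
    show "(\<lambda>_. t) \<longlonglongrightarrow> t" by simp
  qed (use r_bounds in auto)
  have "(\<lambda>n. f (r n)) \<longlonglongrightarrow> f t"
    using cont r r_bounds(3) \<open>t \<ge> 0\<close> by (auto intro: continuous_on_tendsto_compose)
  moreover have "f (r n) = poly P (r n)" for n
    unfolding r_def by (rule frac) simp
  ultimately have "(\<lambda>n. poly P (r n)) \<longlonglongrightarrow> f t"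
    by simp
  then show ?thesis
    unfolding P using LIMSEQ_unique tendsto_poly[OF r] by blast
qed

section \<open>Semigroups and their generators\<close>

text \<open>Writes the derivative as a limit of difference quotients, the form in which
  \<open>is_generator\<close> gives A.\<close>

lemma has_vector_derivative_iff_tendsto:
  "(f has_vector_derivative l) (at t within S) \<longleftrightarrow>
    ((\<lambda>s. (f s - f t) /\<^sub>R (s - t)) \<longlongrightarrow> l) (at t within S)"
proof -
  have eq: "norm (f s - f t - (s - t) *\<^sub>R l) / norm (s - t) = norm ((f s - f t) /\<^sub>R (s - t) - l)"
    if "s \<noteq> t" for s
  proof -
    have "(f s - f t) /\<^sub>R (s - t) - l = (f s - f t - (s - t) *\<^sub>R l) /\<^sub>R (s - t)"
      using that by (simp add: scaleR_diff_right)
    then show ?thesis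
      by (simp add: divide_inverse mult.commute)
  qed
  have "(f has_vector_derivative l) (at t within S) \<longleftrightarrow>
      ((\<lambda>s. norm (f s - f t - (s - t) *\<^sub>R l) / norm (s - t)) \<longlongrightarrow> 0) (at t within S)"
    by (simp add: has_vector_derivative_def has_derivative_iff_norm bounded_linear_scaleR_left)
  also have "\<dots> \<longleftrightarrow> ((\<lambda>s. norm ((f s - f t) /\<^sub>R (s - t) - l)) \<longlongrightarrow> 0) (at t within S)"
    by (rule tendsto_cong) (auto simp: eventually_at_filter eq[simplified] intro!: always_eventually)
  also have "\<dots> \<longleftrightarrow> ((\<lambda>s. (f s - f t) /\<^sub>R (s - t)) \<longlongrightarrow> l) (at t within S)"
    unfolding tendsto_norm_zero_iff by (rule Lim_null[symmetric])
  finally show ?thesis .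
qed

lemma at_zero_within_nonneg: "at 0 within {0..} = at_right (0::real)"
  unfolding at_within_def by (rule arg_cong2[where f=inf]) (auto intro: arg_cong[where f=principal])

lemma tendsto_exp_quotient: "((\<lambda>h. (exp (c * h) - 1) / h) \<longlongrightarrow> c) (at_right (0::real))"
proof -
  have "((\<lambda>h. exp (c * h)) has_real_derivative c) (at 0 within {0<..})"
    by (auto intro!: derivative_eq_intros)
  then show ?thesis
    by (simp add: has_field_derivative_iff)
qed

text \<open>Multiplication by exp (c t) adds c to the generator. This reduces a numerical bound w to
  dissipativity, and the inversion of \<mu> - A to that of the negative of a generator.\<close>

definition rescaled :: "real \<Rightarrow> (real \<Rightarrow> 'a::real_vector \<Rightarrow> 'a) \<Rightarrow> real \<Rightarrow> 'a \<Rightarrow> 'a" where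
  "rescaled c T t x = exp (c * t) *\<^sub>R T t x"

lemma rescaled_rescaled: "rescaled (- c) (rescaled c T) = T"
  by (simp add: rescaled_def fun_eq_iff exp_minus)

lemma tendsto_rescaled_quotient:
  fixes y l :: "'a::real_normed_vector"
  assumes "((\<lambda>h. (T h y - y) /\<^sub>R h) \<longlongrightarrow> l) (at_right 0)"
  shows "((\<lambda>h. (rescaled c T h y - y) /\<^sub>R h) \<longlongrightarrow> l + c *\<^sub>R y) (at_right 0)"
proof -
  have "((\<lambda>h. exp (c * h)) \<longlongrightarrow> exp (c * 0)) (at_right 0)"
    by (intro tendsto_intros)
  then have "((\<lambda>h. exp (c * h) *\<^sub>R ((T h y - y) /\<^sub>R h) + ((exp (c * h) - 1) / h) *\<^sub>R y)
      \<longlongrightarrow> 1 *\<^sub>R l + c *\<^sub>R y) (at_right 0)"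
    using assms tendsto_exp_quotient[of c] by (intro tendsto_add tendsto_scaleR tendsto_const) auto
  then show ?thesis
    by (simp add: rescaled_def algebra_simps divide_inverse)
qed

lemma generatorD:
  assumes "is_generator T D A" "y \<in> D"
  shows "((\<lambda>t. (T t y - y) /\<^sub>R t) \<longlongrightarrow> A y) (at_right 0)"
  using assms by (simp add: is_generator_def)

lemma generatorI:
  assumes "is_generator T D A" "((\<lambda>t. (T t y - y) /\<^sub>R t) \<longlongrightarrow> l) (at_right 0)"
  shows "y \<in> D" "A y = l"
proof -
  show "y \<in> D"
    using assms unfolding is_generator_def by blast
  from tendsto_unique[OF _ generatorD[OF assms(1) this] assms(2)] show "A y = l"
    by simp
qed

text \<open>\<open>locally_bounded\<close> upgrades strong continuity to joint continuity in time
  and vector. The orbit polynomials of an m-isometric semigroup provide it, and so does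
  contractivity of the limit of the Euler schemes.\<close>

locale semigroup_generator =
  fixes T :: "real \<Rightarrow> 'a::complex_hilbert_space \<Rightarrow> 'a" and D A
  assumes C0: "C0_semigroup T"
    and locally_bounded: "\<And>N. \<exists>M\<ge>0. \<forall>t\<in>{0..N}. \<forall>x. norm (T t x) \<le> M * norm x"
    and gen: "is_generator T D A"
    and lin: "linear_operator D A"
begin

lemma T_bounded_operator: "t \<ge> 0 \<Longrightarrow> bounded_operator (T t)"
  using C0 by (simp add: C0_semigroup_def)

lemma T_bounded_linear: "t \<ge> 0 \<Longrightarrow> bounded_linear (T t)"
  using T_bounded_operator by (simp add: bounded_operator_def)

lemma T_0 [simp]: "T 0 x = x"
  using C0 by (simp add: C0_semigroup_def)

lemma T_plus: "s \<ge> 0 \<Longrightarrow> t \<ge> 0 \<Longrightarrow> T (s + t) x = T s (T t x)"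
  using C0 by (simp add: C0_semigroup_def)

lemma T_commute: "s \<ge> 0 \<Longrightarrow> t \<ge> 0 \<Longrightarrow> T s (T t x) = T t (T s x)"
  by (metis T_plus add.commute)

lemma T_diff: "t \<ge> 0 \<Longrightarrow> T t (x - y) = T t x - T t y"
  and T_scaleR: "t \<ge> 0 \<Longrightarrow> T t (r *\<^sub>R x) = r *\<^sub>R T t x"
  using T_bounded_linear[THEN bounded_linear.linear, of t] by (simp_all add: linear_diff linear_scale)

lemma orbit_continuous: "continuous_on {0..} (\<lambda>t. T t x)"
  using C0 by (simp add: C0_semigroup_def)

text \<open>Time and vector move together; the vectors will be difference quotients. Their change is
  controlled by the uniform bound on [0, t + 1], an interval that eventually contains
  \<open>r i\<close>.\<close>

lemma tendsto_T:
  assumes r: "(r \<longlongrightarrow> t) F" and nonneg: "\<forall>\<^sub>F i in F. r i \<ge> 0" and v: "(v \<longlongrightarrow> x) F" and "t \<ge> 0"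
  shows "((\<lambda>i. T (r i) (v i)) \<longlongrightarrow> T t x) F"
proof -
  obtain M where M: "\<And>s x. s \<in> {0..t + 1} \<Longrightarrow> norm (T s x) \<le> M * norm x"
    using locally_bounded[of "t + 1"] by blast
  have bounds: "\<forall>\<^sub>F i in F. r i \<in> {0..t + 1}"
    using order_tendstoD(2)[OF r, of "t + 1"] nonneg by (auto elim: eventually_elim2)
  have zero: "((\<lambda>i. T (r i) (v i - x)) \<longlongrightarrow> 0) F"
  proof (rule Lim_null_comparison)
    show "\<forall>\<^sub>F i in F. norm (T (r i) (v i - x)) \<le> M * norm (v i - x)"
      using bounds by eventually_elim (rule M)
    show "((\<lambda>i. M * norm (v i - x)) \<longlongrightarrow> 0) F"
      using v by (intro tendsto_mult_right_zero tendsto_norm_zero) (simp add: Lim_null[symmetric])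
  qed
  have main: "((\<lambda>i. T (r i) x) \<longlongrightarrow> T t x) F"
    using nonneg \<open>t \<ge> 0\<close>
    by (intro continuous_on_tendsto_compose[OF orbit_continuous r]) auto
  have "((\<lambda>i. T (r i) (v i - x) + T (r i) x) \<longlongrightarrow> 0 + T t x) F"
    by (intro tendsto_add zero main)
  moreover have "\<forall>\<^sub>F i in F. T (r i) (v i - x) + T (r i) x = T (r i) (v i)"
    using nonneg by eventually_elim (simp add: T_diff)
  ultimately show ?thesis
    using tendsto_cong by fastforce
qed

text \<open>The two-sided difference quotient at \<open>t\<close> is a one-sided one at \<open>0\<close>, transported by
  \<open>T (min s t)\<close>.\<close>

lemma orbit_derivative:
  assumes "y \<in> D" "t \<ge> 0"
  shows "((\<lambda>s. T s y) has_vector_derivative T t (A y)) (at t within {0..})"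
proof -
  let ?F = "at t within {0..}"
  define q where "q h = (T h y - y) /\<^sub>R h" for h
  have s: "\<forall>\<^sub>F s in ?F. s \<noteq> t \<and> s \<ge> 0"
    by (auto simp: eventually_at_filter)
  have "LIM s ?F. \<bar>s - t\<bar> :> at_right 0"
    unfolding filterlim_at
  proof
    show "\<forall>\<^sub>F s in ?F. \<bar>s - t\<bar> \<in> {0<..} \<and> \<bar>s - t\<bar> \<noteq> 0"
      using s by eventually_elim auto
    have "((\<lambda>s. \<bar>s - t\<bar>) \<longlongrightarrow> \<bar>t - t\<bar>) ?F"
      by (intro tendsto_intros)
    then show "((\<lambda>s. \<bar>s - t\<bar>) \<longlongrightarrow> 0) ?F"
      by simp
  qed
  then have "((\<lambda>s. q \<bar>s - t\<bar>) \<longlongrightarrow> A y) ?F"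
    using filterlim_compose[OF generatorD[OF gen \<open>y \<in> D\<close>, folded q_def]] by blast
  moreover have "((\<lambda>s. min s t) \<longlongrightarrow> min t t) ?F"
    by (intro tendsto_intros)
  ultimately have "((\<lambda>s. T (min s t) (q \<bar>s - t\<bar>)) \<longlongrightarrow> T t (A y)) ?F"
    using s \<open>t \<ge> 0\<close> by (intro tendsto_T) (auto elim: eventually_mono)
  moreover have "\<forall>\<^sub>F s in ?F. T (min s t) (q \<bar>s - t\<bar>) = (T s y - T t y) /\<^sub>R (s - t)"
    using s
  proof eventually_elim
    case (elim s)
    have T: "T (min s t) (T \<bar>s - t\<bar> y) = T (max s t) y"
      using elim \<open>t \<ge> 0\<close> by (subst T_plus[symmetric]) (auto simp: min_def max_def abs_if)
    show ?case
    proof (cases "s < t")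
      case True
      have "T (min s t) (q \<bar>s - t\<bar>) = (T t y - T s y) /\<^sub>R (t - s)"
        unfolding q_def using elim \<open>t \<ge> 0\<close> True T by (simp add: T_scaleR T_diff min_def max_def)
      also have "\<dots> = (T s y - T t y) /\<^sub>R (s - t)"
        by (metis inverse_minus_eq minus_diff_eq scaleR_minus_left scaleR_minus_right minus_minus)
      finally show ?thesis .
    next
      case False
      then show ?thesis
        unfolding q_def using elim \<open>t \<ge> 0\<close> T by (simp add: T_scaleR T_diff min_def max_def split: if_splits)
    qed
  qed
  ultimately show ?thesis
    unfolding has_vector_derivative_iff_tendsto by (simp cong: tendsto_cong)
qed

text \<open>The bounded operator \<open>T t\<close> commutes with \<open>T h\<close> and so passes
  through the difference quotient.\<close>

lemma T_invariant:
  assumes "y \<in> D" "t \<ge> 0"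
  shows "T t y \<in> D" "A (T t y) = T t (A y)"
proof -
  have "((\<lambda>h. T t ((T h y - y) /\<^sub>R h)) \<longlongrightarrow> T t (A y)) (at_right 0)"
    by (rule bounded_linear.tendsto[OF T_bounded_linear[OF \<open>t \<ge> 0\<close>] generatorD[OF gen \<open>y \<in> D\<close>]])
  moreover have "\<forall>\<^sub>F h in at_right 0. T t ((T h y - y) /\<^sub>R h) = (T h (T t y) - T t y) /\<^sub>R h"
    unfolding eventually_at_filter
    using \<open>t \<ge> 0\<close> by (intro always_eventually) (simp add: T_scaleR T_diff T_commute)
  ultimately have "((\<lambda>h. (T h (T t y) - T t y) /\<^sub>R h) \<longlongrightarrow> T t (A y)) (at_right 0)"
    by (simp cong: tendsto_cong)
  from generatorI[OF gen this] show "T t y \<in> D" "A (T t y) = T t (A y)" .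
qed

lemma funpow_invariant:
  assumes "y \<in> power_domain D A n" "t \<ge> 0"
  shows "T t y \<in> power_domain D A n" "k \<le> n \<Longrightarrow> (A ^^ k) (T t y) = T t ((A ^^ k) y)"
  using assms
proof (induction n arbitrary: y k)
  case (Suc n)
  {
    case 1
    then show ?case
      using Suc.IH(1)[of "A y"] by (simp add: T_invariant)
  next
    case 2
    then show ?case
      using Suc.IH(2)[of "k - 1" "A y"] by (cases k) (simp_all add: T_invariant funpow_Suc_right del: funpow.simps(2))
  }
qed simp_all

section \<open>Integrals along orbits; density of the domains of powers\<close>

definition orbit_integral :: "'a \<Rightarrow> real \<Rightarrow> 'a" where
  "orbit_integral x u = integral {0..u} (\<lambda>t. T t x)"

lemma orbit_integrable: "0 \<le> a \<Longrightarrow> (\<lambda>t. T t x) integrable_on {a..b}"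
  by (intro integrable_continuous_real continuous_on_subset[OF orbit_continuous]) auto

lemma orbit_integral_right_derivative:
  assumes "u \<ge> 0"
  shows "((\<lambda>h. (orbit_integral x (u + h) - orbit_integral x u) /\<^sub>R h) \<longlongrightarrow> T u x) (at_right 0)"
proof -
  \<comment> \<open>The interval ends beyond u, so that the derivative at u sees times to the right
    of u.\<close>
  have "((orbit_integral x) has_vector_derivative T u x) (at u within {0..u+1})"
    unfolding orbit_integral_def
    using assms by (intro integral_has_vector_derivative continuous_on_subset[OF orbit_continuous]) auto
  then have lim: "((\<lambda>s. (orbit_integral x s - orbit_integral x u) /\<^sub>R (s - u)) \<longlongrightarrow> T u x) (at u within {0..u+1})"
    by (simp add: has_vector_derivative_iff_tendsto)
  have "LIM h at_right 0. u + h :> at u within {0..u+1}"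
    unfolding filterlim_at
  proof
    show "\<forall>\<^sub>F h in at_right 0. u + h \<in> {0..u + 1} \<and> u + h \<noteq> u"
      using assms by (auto simp: eventually_at intro!: exI[of _ 1] simp: dist_norm)
    have "((\<lambda>h. u + h) \<longlongrightarrow> u + 0) (at_right 0)"
      by (intro tendsto_intros)
    then show "((\<lambda>h. u + h) \<longlongrightarrow> u) (at_right 0)"
      by simp
  qed
  from filterlim_compose[OF lim this] show ?thesis
    by simp
qed

lemma T_orbit_integral:
  assumes "u \<ge> 0" "h \<ge> 0"
  shows "T h (orbit_integral x u) = orbit_integral x (u + h) - orbit_integral x h"
proof -
  have "T h (orbit_integral x u) = integral {0..u} (\<lambda>t. T h (T t x))"
    unfolding orbit_integral_def
    using integral_linear[OF orbit_integrable[where a=0 and x=x and b=u] T_bounded_linear[OF \<open>h \<ge> 0\<close>]]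
    by (simp add: o_def)
  also have "\<dots> = integral {0..u} (\<lambda>t. T (t + h) x)"
    using assms by (intro integral_cong) (simp add: T_plus T_commute)
  also have "\<dots> = integral {h..u + h} (\<lambda>t. T t x)"
    using has_integral_affinity[OF integrable_integral[OF orbit_integrable[OF \<open>h \<ge> 0\<close>, where x=x and b="u + h", folded box_real(2)]], of 1 h]
    by (intro integral_unique) (simp add: algebra_simps)
  also have "\<dots> = orbit_integral x (u + h) - orbit_integral x h"
    unfolding orbit_integral_def
    using Henstock_Kurzweil_Integration.integral_combine[where a=0 and c=h and b="u + h" and f="\<lambda>t. T t x"] assms orbit_integrable[where a=0 and x=x and b="u + h"]
    by (simp add: algebra_simps)
  finally show ?thesis .
qed

text \<open>T h - 1 turns the integral over [0, u] into the integral over [u, u + h] minus the one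
  over [0, h]. After division by h these are averages that converge to the orbit at u and at
  0.\<close>

lemma orbit_integral_in_domain:
  assumes "u \<ge> 0"
  shows "orbit_integral x u \<in> D" "A (orbit_integral x u) = T u x - x"
proof -
  have "orbit_integral x 0 = 0"
    by (simp add: orbit_integral_def)
  then have "((\<lambda>h. (orbit_integral x (u + h) - orbit_integral x u) /\<^sub>R h - orbit_integral x h /\<^sub>R h)
      \<longlongrightarrow> T u x - x) (at_right 0)"
    using tendsto_diff[OF orbit_integral_right_derivative[OF assms]
        orbit_integral_right_derivative[OF order_refl], of x x] by simp
  moreover have "\<forall>\<^sub>F h in at_right 0.
      (orbit_integral x (u + h) - orbit_integral x u) /\<^sub>R h - orbit_integral x h /\<^sub>R h =
      (T h (orbit_integral x u) - orbit_integral x u) /\<^sub>R h"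
    using assms
    by (auto simp: eventually_at_filter T_orbit_integral algebra_simps intro!: always_eventually)
  ultimately have "((\<lambda>h. (T h (orbit_integral x u) - orbit_integral x u) /\<^sub>R h) \<longlongrightarrow> T u x - x) (at_right 0)"
    by (simp cong: tendsto_cong)
  from generatorI[OF gen this]
  show "orbit_integral x u \<in> D" "A (orbit_integral x u) = T u x - x" .
qed

lemma orbit_integral_generator:
  assumes "y \<in> D" "u \<ge> 0"
  shows "orbit_integral (A y) u = T u y - y"
proof -
  have "((\<lambda>t. T t (A y)) has_integral (T u y - T 0 y)) {0..u}"
    using assms
    by (intro fundamental_theorem_of_calculus has_vector_derivative_within_subset[OF orbit_derivative]) auto
  then show ?thesis
    by (simp add: orbit_integral_def integral_unique)
qed

lemma norm_orbit_integral_le: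
  assumes "u \<ge> 0" "\<And>t. t \<in> {0..u} \<Longrightarrow> norm (T t x) \<le> B"
  shows "norm (orbit_integral x u) \<le> B * u"
  using integral_bound[of 0 u "\<lambda>t. T t x" B] assms continuous_on_subset[OF orbit_continuous]
  by (simp add: orbit_integral_def)

lemma power_domain_linear:
  "x \<in> power_domain D A n \<Longrightarrow> y \<in> power_domain D A n \<Longrightarrow> x - y \<in> power_domain D A n"
  "x \<in> power_domain D A n \<Longrightarrow> r *\<^sub>R x \<in> power_domain D A n"
  by (induction n arbitrary: x y) (auto simp: linear_operator_simps[OF lin])

text \<open>Averaging the orbit over [0, h] gains one power of A and tends to y as h tends to 0.
  Hence each \<open>power_domain\<close> lies in the closure of the next.\<close>

lemma power_domain_dense: "closure (power_domain D A n) = UNIV"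
proof (induction n)
  case (Suc n)
  have "y \<in> closure (power_domain D A (Suc n))" if "y \<in> power_domain D A n" for y
  proof -
    have "((\<lambda>h. orbit_integral y h /\<^sub>R h) \<longlongrightarrow> y) (at_right 0)"
      using orbit_integral_right_derivative[of 0 y] by (simp add: orbit_integral_def)
    moreover have "orbit_integral y h /\<^sub>R h \<in> power_domain D A (Suc n)" if "h > 0" for h
      using that \<open>y \<in> power_domain D A n\<close> orbit_integral_in_domain[of h y]
      by (auto simp: linear_operator_simps[OF lin] funpow_invariant intro!: power_domain_linear)
    then have "\<forall>\<^sub>F h in at_right 0. orbit_integral y h /\<^sub>R h \<in> closure (power_domain D A (Suc n))"
      by (intro eventually_at_rightI[of 0 1]) (auto intro: closure_subset[THEN subsetD])
    ultimately show ?thesis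
      by (intro Lim_in_closed_set[OF closed_closure]) auto
  qed
  then show ?case
    using Suc.IH closure_mono[of "power_domain D A n" "closure (power_domain D A (Suc n))"]
    by (auto simp: subset_iff)
qed simp

lemma domain_dense: "closure D = UNIV"
  using power_domain_dense[of 1] by simp

lemma rescaled_semigroup_generator:
  "semigroup_generator (rescaled c T) D (\<lambda>y. A y + c *\<^sub>R y)"
proof
  have "bounded_operator (rescaled c T t)" if "t \<ge> 0" for t
    using T_bounded_operator[OF that] unfolding bounded_operator_def rescaled_def
    by (auto intro: bounded_linear_compose[OF bounded_linear_scaleR_right])
      (simp add: scaleR_scaleC scaleC_scaleC mult.commute)
  moreover have "continuous_on {0..} (\<lambda>t. rescaled c T t x)" for x
    unfolding rescaled_def by (intro continuous_intros orbit_continuous)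
  ultimately show "C0_semigroup (rescaled c T)"
    unfolding C0_semigroup_def
    by (auto simp: rescaled_def fun_eq_iff T_plus T_scaleR exp_add distrib_left)
next
  fix N :: real
  obtain M where M: "M \<ge> 0" "\<And>t x. t \<in> {0..N} \<Longrightarrow> norm (T t x) \<le> M * norm x"
    using locally_bounded[of N] by blast
  have "norm (rescaled c T t x) \<le> exp (\<bar>c\<bar> * N) * M * norm x" if "t \<in> {0..N}" for t x
  proof -
    have "c * t \<le> \<bar>c\<bar> * N"
      using that by (intro mult_mono) auto
    then have "exp (c * t) * norm (T t x) \<le> exp (\<bar>c\<bar> * N) * (M * norm x)"
      using M that by (intro mult_mono) auto
    then show ?thesis
      by (simp add: rescaled_def mult.assoc)
  qed
  then show "\<exists>M\<ge>0. \<forall>t\<in>{0..N}. \<forall>x. norm (rescaled c T t x) \<le> M * norm x"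
    using M(1) by (intro exI[of _ "exp (\<bar>c\<bar> * N) * M"]) auto
next
  have "y \<in> D \<longleftrightarrow> (\<exists>l. ((\<lambda>t. (rescaled c T t y - y) /\<^sub>R t) \<longlongrightarrow> l) (at_right 0))" for y
  proof
    show "\<exists>l. ((\<lambda>t. (rescaled c T t y - y) /\<^sub>R t) \<longlongrightarrow> l) (at_right 0)" if "y \<in> D"
      using tendsto_rescaled_quotient[of T y "A y" c] generatorD[OF gen that] by blast
    \<comment> \<open>Rescaling by -c undoes the rescaling, so the domain cannot have grown.\<close>
    assume "\<exists>l. ((\<lambda>t. (rescaled c T t y - y) /\<^sub>R t) \<longlongrightarrow> l) (at_right 0)"
    then obtain l where "((\<lambda>t. (rescaled c T t y - y) /\<^sub>R t) \<longlongrightarrow> l) (at_right 0)"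
      by blast
    from tendsto_rescaled_quotient[of "rescaled c T" y l "- c", OF this] show "y \<in> D"
      unfolding rescaled_rescaled by (rule generatorI(1)[OF gen])
  qed
  then show "is_generator (rescaled c T) D (\<lambda>y. A y + c *\<^sub>R y)"
    unfolding is_generator_def by (auto intro: tendsto_rescaled_quotient generatorD[OF gen])
next
  show "linear_operator D (\<lambda>y. A y + c *\<^sub>R y)"
    using lin unfolding linear_operator_def
    by (auto simp: algebra_simps scaleR_scaleC scaleC_scaleC scaleC_add_right)
qed

text \<open>With \<open>V x = \<integral>\<^sub>0\<^sup>N T t x dt\<close> one has \<open>- A (V x) = x - T N x\<close> and \<open>- V (A y) = y - T N y\<close>. Thus
  \<open>- A\<close> inherits surjectivity and a lower bound from the invertible operator \<open>1 - T N\<close>; no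
  improper integral is needed.\<close>

lemma invertible_generator:
  assumes "N \<ge> 0" and half: "\<And>x. norm (T N x) \<le> 1 / 2 * norm x"
  shows "invertible_operator D (\<lambda>y. - A y)"
proof -
  obtain M where M: "\<And>t x. t \<in> {0..N} \<Longrightarrow> norm (T t x) \<le> M * norm x"
    using locally_bounded[of N] by blast
  show ?thesis
  proof (rule invertible_operatorI)
    show "linear_operator D (\<lambda>y. - A y)"
      using linear_operator_scaleR_diff[OF lin, of 0 1] by simp
    show "norm y \<le> 2 * M * N * norm (- A y)" if "y \<in> D" for y
    proof -
      \<comment> \<open>\<open>T N\<close> contributes at most half of \<open>norm y\<close>, which
        is absorbed on the left; hence the factor 2.\<close>
      have "norm y = norm (T N y - orbit_integral (A y) N)"
        using orbit_integral_generator[OF that \<open>N \<ge> 0\<close>] by simp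
      also have "\<dots> \<le> norm (T N y) + norm (orbit_integral (A y) N)"
        by (rule norm_triangle_ineq4)
      also have "\<dots> \<le> 1 / 2 * norm y + M * norm (A y) * N"
        using half[of y] norm_orbit_integral_le[OF \<open>N \<ge> 0\<close> M] by (intro add_mono) auto
      finally show ?thesis by (simp add: algebra_simps)
    qed
    have "x \<in> (\<lambda>y. - A y) ` D" for x
    proof -
      obtain z where "z - T N z = x"
        using contraction_perturbation_surj[of "T N" "1 / 2" x] half T_diff[OF \<open>N \<ge> 0\<close>] by auto
      then show ?thesis
        using orbit_integral_in_domain[OF \<open>N \<ge> 0\<close>, of z] by (intro rev_image_eqI[of "orbit_integral z N"]) auto
    qed
    then show "(\<lambda>y. - A y) ` D = UNIV" by blast
  qed
qed

end

section \<open>Generation of contraction semigroups\<close>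

text \<open>Pair l y - z with y and use Cauchy-Schwarz. The vector z is left free so that both A y
  and h A y can be inserted.\<close>

lemma dissipative_lower_bound:
  assumes "Re (cinner z y) \<le> w * (norm y)\<^sup>2"
  shows "(l - w) * norm y \<le> norm (l *\<^sub>R y - z)"
proof (cases "y = 0")
  case False
  have "(l - w) * norm y * norm y \<le> Re (cinner (l *\<^sub>R y - z) y)"
    using assms by (simp add: Re_cinner_simps Re_cinner_self power2_eq_square algebra_simps)
  also have "\<dots> \<le> norm (l *\<^sub>R y - z) * norm y"
    by (rule Re_cinner_le)
  finally show ?thesis
    using False by simp
qed simp

text \<open>Continuation in the spectral parameter: the inverse of a - A has norm at most 1 / a, so
  perturbation reaches every b with |a - b| < a, that is 0 < b < 2 a. Geometric growth from \<mu>
  passes l, and one last step leads down to l.\<close>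

lemma dissipative_surj:
  assumes lin: "linear_operator D A" and diss: "\<And>y. y \<in> D \<Longrightarrow> Re (cinner (A y) y) \<le> 0"
    and "\<mu> > 0" and surj: "(\<lambda>y. \<mu> *\<^sub>R y - A y) ` D = UNIV" and "l > 0"
  shows "(\<lambda>y. l *\<^sub>R y - A y) ` D = UNIV"
proof -
  have lower: "a * norm y \<le> norm (a *\<^sub>R y - A y)" if "y \<in> D" for a y
    using dissipative_lower_bound[of "A y" y 0 a] diss[OF that] by simp
  have step: "(\<lambda>y. b *\<^sub>R y - A y) ` D = UNIV"
    if "0 < b" "b < 2 * a" and surj: "(\<lambda>y. a *\<^sub>R y - A y) ` D = UNIV" for a b
  proof -
    have "a > 0"
      using that by simp
    have "invertible_operator D (\<lambda>y. a *\<^sub>R y - A y)"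
      using linear_operator_scaleR_diff[OF lin, of a 1] lower[of _ a] \<open>a > 0\<close>
      by (intro invertible_operatorI[where C="1 / a"] surj) (simp_all add: field_simps)
    then obtain R where R: "bounded_operator R" "\<And>x. R x \<in> D" "\<And>x. a *\<^sub>R R x - A (R x) = x"
      unfolding invertible_operator_def by blast
    have R_diff: "R (x - y) = R x - R y" for x y
      using R(1) by (simp add: bounded_operator_def bounded_linear.linear linear_diff)
    have R_norm: "norm (R x) \<le> norm x / a" for x
      using lower[OF R(2), of a x] \<open>a > 0\<close> by (simp add: R(3) field_simps)
    have "x \<in> (\<lambda>y. b *\<^sub>R y - A y) ` D" for x
    proof -
      have "\<exists>z. z - (a - b) *\<^sub>R R z = x"
      proof (rule contraction_perturbation_surj)
        show "norm ((a - b) *\<^sub>R R z) \<le> \<bar>a - b\<bar> / a * norm z" for z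
          using mult_left_mono[OF R_norm[of z], of "\<bar>a - b\<bar>"] by simp
      qed (use that \<open>a > 0\<close> in \<open>auto simp: R_diff scaleR_diff_right\<close>)
      then obtain z where z: "z - (a - b) *\<^sub>R R z = x" ..
      \<comment> \<open>b - A is (a - A) minus (a - b); on R z this gives z - (a - b) R z.\<close>
      have "b *\<^sub>R R z - A (R z) = (a *\<^sub>R R z - A (R z)) - (a - b) *\<^sub>R R z"
        by (simp add: algebra_simps)
      also have "\<dots> = x"
        by (simp add: R(3) z)
      finally show ?thesis
        using R(2)[of z] by (intro rev_image_eqI[of "R z"]) auto
    qed
    then show ?thesis by blast
  qed
  \<comment> \<open>Any ratio strictly between 1 and 2 serves for the climb.\<close>
  have pow: "(\<lambda>y. ((3/2) ^ n * \<mu>) *\<^sub>R y - A y) ` D = UNIV" for n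
  proof (induction n)
    case (Suc n)
    show ?case
      by (rule step[OF _ _ Suc.IH]) (use \<open>\<mu> > 0\<close> in auto)
  qed (simp add: surj)
  obtain n where "l / \<mu> < (3/2) ^ n"
    using real_arch_pow[of "3/2" "l / \<mu>"] by auto
  then have "l < (3/2) ^ n * \<mu>"
    using \<open>\<mu> > 0\<close> by (simp add: pos_divide_less_eq)
  then have "l < 2 * ((3/2) ^ n * \<mu>)"
    using \<open>l > 0\<close> by linarith
  then show ?thesis
    using step[OF \<open>l > 0\<close> _ pow[of n]] by simp
qed

lemma dense_approx:
  fixes x :: "'a::real_normed_vector"
  assumes "closure E = UNIV" "e > 0"
  shows "\<exists>y\<in>E. norm (x - y) < e"
  using closure_approachable[of x E] assms by (metis UNIV_I dist_commute dist_norm)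

lemma convergent_on_dense:
  fixes S :: "nat \<Rightarrow> 'a::real_normed_vector \<Rightarrow> 'b::banach"
  assumes dense: "closure E = UNIV" and diff: "\<And>k x y. S k (x - y) = S k x - S k y"
    and contr: "\<And>k x. norm (S k x) \<le> norm x" and conv: "\<And>y. y \<in> E \<Longrightarrow> convergent (\<lambda>k. S k y)"
  shows "convergent (\<lambda>k. S k x)"
proof -
  have "Cauchy (\<lambda>k. S k x)"
  proof (rule metric_CauchyI)
    fix e :: real
    assume "e > 0"
    then obtain y where y: "y \<in> E" "norm (x - y) < e / 3"
      using dense_approx[OF dense, of "e / 3" x] by auto
    have "Cauchy (\<lambda>k. S k y)"
      using conv[OF y(1)] by (rule convergent_Cauchy)
    then obtain M where M: "\<And>m n. m \<ge> M \<Longrightarrow> n \<ge> M \<Longrightarrow> dist (S m y) (S n y) < e / 3"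
      using metric_CauchyD \<open>e > 0\<close> by (metis zero_less_divide_iff zero_less_numeral)
    have near: "dist (S k x) (S k y) < e / 3" for k
      using contr[of k "x - y"] y(2) by (simp add: dist_norm diff)
    have "dist (S m x) (S n x) < e" if "m \<ge> M" "n \<ge> M" for m n
      using near[of m] near[of n] M[OF that] by metric
    then show "\<exists>M. \<forall>m\<ge>M. \<forall>n\<ge>M. dist (S m x) (S n x) < e"
      by blast
  qed
  then show ?thesis
    by (simp add: Cauchy_convergent_iff)
qed

lemma eq_on_dense:
  fixes f g :: "'a::topological_space \<Rightarrow> 'b::t2_space"
  assumes "closure E = UNIV" "continuous_on UNIV f" "continuous_on UNIV g" "\<And>y. y \<in> E \<Longrightarrow> f y = g y"
  shows "f x = g x"
proof -
  have "closed {x. f x = g x}"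
    using assms by (intro closed_Collect_eq)
  then have "closure E \<subseteq> {x. f x = g x}"
    using assms(4) by (intro closure_minimal) auto
  then show ?thesis
    using assms(1) by auto
qed

section \<open>Backward Euler steps of a dissipative operator\<close>

locale dissipative_operator =
  fixes D :: "'a::complex_hilbert_space set" and A
  assumes lin: "linear_operator D A"
    and dense: "closure D = UNIV"
    and dissipative: "\<And>y. y \<in> D \<Longrightarrow> Re (cinner (A y) y) \<le> 0"
    and surj_one: "\<exists>\<mu>>0. (\<lambda>y. \<mu> *\<^sub>R y - A y) ` D = UNIV"
begin

lemma lower_bound: "h \<ge> 0 \<Longrightarrow> y \<in> D \<Longrightarrow> norm y \<le> norm (y - h *\<^sub>R A y)"
  using dissipative_lower_bound[of "h *\<^sub>R A y" y 0 1] dissipative[of y]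
  by (simp add: Re_cinner_simps mult_nonneg_nonpos)

lemma surj:
  assumes "h > 0"
  shows "(\<lambda>y. y - h *\<^sub>R A y) ` D = UNIV"
proof -
  obtain \<mu> where "\<mu> > 0" "(\<lambda>y. \<mu> *\<^sub>R y - A y) ` D = UNIV"
    using surj_one by blast
  from dissipative_surj[OF lin dissipative this, of "1 / h"] \<open>h > 0\<close>
  have surj: "(\<lambda>y. (1 / h) *\<^sub>R y - A y) ` D = UNIV"
    by simp
  have "x \<in> (\<lambda>y. y - h *\<^sub>R A y) ` D" for x
  proof -
    have "(1 / h) *\<^sub>R x \<in> (\<lambda>y. (1 / h) *\<^sub>R y - A y) ` D"
      unfolding surj by simp
    then obtain y where y: "y \<in> D" "(1 / h) *\<^sub>R x = (1 / h) *\<^sub>R y - A y"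
      by blast
    have "x = h *\<^sub>R ((1 / h) *\<^sub>R x)"
      using \<open>h > 0\<close> by simp
    also have "\<dots> = y - h *\<^sub>R A y"
      unfolding y(2) using \<open>h > 0\<close> by (simp add: scaleR_diff_right)
    finally show ?thesis
      using y(1) by blast
  qed
  then show ?thesis by blast
qed

text \<open>One backward Euler step (1 - h A)^(-1), which is 1 / h times the resolvent of A at 1 /
  h. The choice is used for h > 0.\<close>

definition J :: "real \<Rightarrow> 'a \<Rightarrow> 'a" where
  "J h = (SOME R. bounded_operator R \<and> (\<forall>x. R x \<in> D \<and> R x - h *\<^sub>R A (R x) = x) \<and>
    (\<forall>y\<in>D. R (y - h *\<^sub>R A y) = y))"

lemma J:
  assumes "h > 0"
  shows J_bounded_operator: "bounded_operator (J h)"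
    and J_in_D: "J h x \<in> D"
    and J_right: "J h x - h *\<^sub>R A (J h x) = x"
    and J_left: "y \<in> D \<Longrightarrow> J h (y - h *\<^sub>R A y) = y"
proof -
  have "invertible_operator D (\<lambda>y. y - h *\<^sub>R A y)"
    using linear_operator_scaleR_diff[OF lin, of 1 h] lower_bound[of h] surj[OF assms] assms
    by (intro invertible_operatorI[where C=1]) simp_all
  from someI_ex[OF this[unfolded invertible_operator_def], folded J_def]
  show "bounded_operator (J h)" "J h x \<in> D" "J h x - h *\<^sub>R A (J h x) = x"
    "y \<in> D \<Longrightarrow> J h (y - h *\<^sub>R A y) = y"
    by blast+
qed

lemma Jn_bounded_operator: "h > 0 \<Longrightarrow> bounded_operator (J h ^^ n)"
  by (intro bounded_operator_funpow J_bounded_operator)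

lemma Jn_bounded_linear: "h > 0 \<Longrightarrow> bounded_linear (J h ^^ n)"
  using Jn_bounded_operator by (auto simp: bounded_operator_def)

lemmas Jn_diff = linear_diff[OF bounded_linear.linear[OF Jn_bounded_linear]]
lemmas Jn_add = linear_add[OF bounded_linear.linear[OF Jn_bounded_linear]]
lemmas Jn_scaleR = linear_scale[OF bounded_linear.linear[OF Jn_bounded_linear]]

lemma J_diff: "h > 0 \<Longrightarrow> J h (x - y) = J h x - J h y"
  and J_scaleR: "h > 0 \<Longrightarrow> J h (r *\<^sub>R x) = r *\<^sub>R J h x"
  using Jn_diff[of h 1 x y] Jn_scaleR[of h 1 r x] by simp_all

lemma J_norm: "h > 0 \<Longrightarrow> norm (J h x) \<le> norm x"
  using lower_bound[of h "J h x"] by (simp add: J_right J_in_D)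

lemma Jn_norm: "h > 0 \<Longrightarrow> norm ((J h ^^ n) x) \<le> norm x"
  by (induction n) (auto intro: order_trans[OF J_norm])

lemma J_A:
  assumes "h > 0" "y \<in> D"
  shows "A (J h y) = J h (A y)" "J h y - y = h *\<^sub>R J h (A y)"
proof -
  have r: "h *\<^sub>R A (J h y) = J h y - y"
    using J_right[OF assms(1), of y] by (simp add: algebra_simps)
  show l: "J h y - y = h *\<^sub>R J h (A y)"
    using J_left[OF assms] assms(1) by (simp add: J_diff J_scaleR algebra_simps)
  show "A (J h y) = J h (A y)"
    using r assms(1) unfolding l by simp
qed

lemma Jn_A:
  assumes "h > 0" "y \<in> D"
  shows "(J h ^^ n) y \<in> D" "A ((J h ^^ n) y) = (J h ^^ n) (A y)"
  using assms by (induction n) (auto simp: J_in_D J_A)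

lemma Jn_near:
  assumes "h > 0" "y \<in> D"
  shows "norm ((J h ^^ n) y - y) \<le> real n * h * norm (A y)"
proof (induction n)
  case (Suc n)
  have "(J h ^^ Suc n) y - y = (J h ^^ n) (J h y - y) + ((J h ^^ n) y - y)"
    using assms by (simp add: Jn_diff funpow_swap1)
  then have "norm ((J h ^^ Suc n) y - y) \<le> norm ((J h ^^ n) (J h y - y)) + norm ((J h ^^ n) y - y)"
    by (metis norm_triangle_ineq)
  also have "norm ((J h ^^ n) (J h y - y)) \<le> norm (J h y - y)"
    using assms by (intro Jn_norm)
  also have "\<dots> \<le> h * norm (A y)"
    using J_norm[of h "A y"] assms by (simp add: J_A(2))
  finally show ?case
    using Suc.IH by (simp add: algebra_simps)
qed simp

text \<open>The steps common to both sides form a contraction, so only the surplus of |a - b| steps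
  counts.\<close>

lemma Jn_Lipschitz:
  assumes "h > 0" "y \<in> D"
  shows "norm ((J h ^^ a) y - (J h ^^ b) y) \<le> \<bar>real a - real b\<bar> * h * norm (A y)"
proof -
  have "norm ((J h ^^ (b + n)) y - (J h ^^ b) y) \<le> real n * h * norm (A y)" for b n
    using Jn_norm[of h b "(J h ^^ n) y - y"] Jn_near[of h y n] assms
    by (simp add: funpow_add Jn_diff)
  from this[of a "b - a"] this[of b "a - b"] show ?thesis
    by (cases "a \<le> b") (simp_all add: norm_minus_commute of_nat_diff)
qed

text \<open>For x outside D, move to z in D and pay for x - z twice. The first-order estimate
  applies this to A y, which need not lie in D.\<close>

lemma Jn_near_approx:
  assumes "h > 0" "z \<in> D"
  shows "norm ((J h ^^ n) x - x) \<le> 2 * norm (x - z) + real n * h * norm (A z)"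
proof -
  have "(J h ^^ n) x - x = (J h ^^ n) (x - z) + ((J h ^^ n) z - z) - (x - z)"
    using assms by (simp add: Jn_diff)
  then have "norm ((J h ^^ n) x - x) \<le> norm ((J h ^^ n) (x - z)) + norm ((J h ^^ n) z - z) + norm (x - z)"
    by (simp only:) (intro order_trans[OF norm_triangle_ineq4] add_right_mono norm_triangle_ineq)
  then show ?thesis
    using Jn_norm[of h n "x - z"] Jn_near[of h z n] assms by simp
qed

text \<open>The j-th step adds h J^j (A y), so the error collects the deviations of J^j (A y) from A
  y. The bound depends on n and h only through n h and therefore survives refinement of the
  step.\<close>

lemma Jn_first_order:
  assumes "h > 0" "y \<in> D" "z \<in> D"
  shows "norm ((J h ^^ n) y - y - (real n * h) *\<^sub>R A y) \<le>
    real n * h * (2 * norm (A y - z) + real n * h * norm (A z))"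
proof (induction n)
  case (Suc n)
  have "(J h ^^ Suc n) y - (J h ^^ n) y = (J h ^^ n) (J h y - y)"
    using assms by (simp add: Jn_diff funpow_swap1)
  also have "\<dots> = h *\<^sub>R (J h ^^ Suc n) (A y)"
    using assms by (simp add: J_A(2) Jn_scaleR funpow_swap1)
  finally have eq: "(J h ^^ Suc n) y - y - (real (Suc n) * h) *\<^sub>R A y =
      ((J h ^^ n) y - y - (real n * h) *\<^sub>R A y) + h *\<^sub>R ((J h ^^ Suc n) (A y) - A y)"
    by (simp add: algebra_simps)
  have "norm (h *\<^sub>R ((J h ^^ Suc n) (A y) - A y)) \<le>
      h * (2 * norm (A y - z) + real (Suc n) * h * norm (A z))"
    using assms Jn_near_approx[OF assms(1,3), of "Suc n" "A y"] by simp
  moreover have "norm ((J h ^^ n) y - y - (real n * h) *\<^sub>R A y) \<le>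
      real n * h * (2 * norm (A y - z) + real (Suc n) * h * norm (A z))"
    using Suc.IH assms by (elim order_trans) (intro mult_left_mono add_left_mono mult_right_mono, auto)
  ultimately show ?case
    unfolding eq by (intro norm_triangle_le) (simp add: algebra_simps)
qed simp

text \<open>Comparing backward Euler steps of sizes \<open>h\<close> and \<open>h / 2\<close>:
  \<open>(1 - h A/2)\<^sup>2 - (1 - h A) = h\<^sup>2 A\<^sup>2 / 4\<close>.\<close>

lemma J_halving:
  assumes "h > 0" "y \<in> D" "A y \<in> D"
  shows "norm (J h y - J (h / 2) (J (h / 2) y)) \<le> h\<^sup>2 / 4 * norm (A (A y))"
proof -
  define u where "u = J (h / 2) y"
  define v where "v = J (h / 2) u"
  have pos: "h / 2 > 0"
    using assms by simp
  have v: "v \<in> D" "A v \<in> D" "A (A v) = J (h / 2) (J (h / 2) (A (A y)))"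
    using assms pos unfolding u_def v_def by (simp_all add: J_in_D J_A)
  have "v - (h / 2) *\<^sub>R A v = u" "u - (h / 2) *\<^sub>R A u = y"
    using J_right[OF pos] by (simp_all add: u_def v_def)
  then have "y = (v - (h / 2) *\<^sub>R A v) - (h / 2) *\<^sub>R (A v - (h / 2) *\<^sub>R A (A v))"
    using v by (metis linear_operator_simps(6,7,9)[OF lin])
  also have "\<dots> = (v - h *\<^sub>R A v) + (h\<^sup>2 / 4) *\<^sub>R A (A v)"
    by (simp add: algebra_simps power2_eq_square flip: scaleR_add_left)
  finally have "y = (v - h *\<^sub>R A v) + (h\<^sup>2 / 4) *\<^sub>R A (A v)" .
  then have "J h y = J h (v - h *\<^sub>R A v) + (h\<^sup>2 / 4) *\<^sub>R J h (A (A v))"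
    using Jn_add[of h 1 "v - h *\<^sub>R A v" "(h\<^sup>2 / 4) *\<^sub>R A (A v)"] assms by (simp add: J_scaleR)
  then have "J h y - v = (h\<^sup>2 / 4) *\<^sub>R J h (A (A v))"
    using J_left[OF assms(1) v(1)] by simp
  moreover have "norm (J h (A (A v))) \<le> norm (A (A y))"
    unfolding v(3) using assms pos by (meson J_norm order_trans)
  ultimately show ?thesis
    by (simp add: u_def v_def mult_left_mono)
qed

text \<open>Local errors add up without amplification: the coarse step is a contraction, and A^2
  commutes with the half steps, so A^2 v never exceeds A^2 y in norm.\<close>

lemma Jn_halving:
  assumes "h > 0" "y \<in> D" "A y \<in> D"
  shows "norm ((J h ^^ n) y - (J (h / 2) ^^ (2 * n)) y) \<le> real n * (h\<^sup>2 / 4 * norm (A (A y)))"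
proof (induction n)
  case (Suc n)
  define v where "v = (J (h / 2) ^^ (2 * n)) y"
  have pos: "h / 2 > 0"
    using assms by simp
  have v: "v \<in> D" "A v \<in> D" "norm (A (A v)) \<le> norm (A (A y))"
    using assms pos Jn_norm[OF pos] unfolding v_def by (simp_all add: Jn_A)
  have "(J h ^^ Suc n) y - (J (h / 2) ^^ (2 * Suc n)) y =
      J h ((J h ^^ n) y - v) + (J h v - J (h / 2) (J (h / 2) v))"
    using assms by (simp add: v_def J_diff)
  also have "norm \<dots> \<le> real n * (h\<^sup>2 / 4 * norm (A (A y))) + h\<^sup>2 / 4 * norm (A (A y))"
  proof (rule norm_triangle_mono)
    show "norm (J h ((J h ^^ n) y - v)) \<le> real n * (h\<^sup>2 / 4 * norm (A (A y)))"
      using J_norm[OF assms(1)] Suc.IH unfolding v_def by (rule order_trans)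
    show "norm (J h v - J (h / 2) (J (h / 2) v)) \<le> h\<^sup>2 / 4 * norm (A (A y))"
      using J_halving[OF assms(1) v(1,2)] v(3) by (elim order_trans) (intro mult_left_mono, auto)
  qed
  finally show ?case
    by (simp add: algebra_simps)
qed simp

section \<open>Dyadic Euler schemes and their convergence\<close>

definition steps :: "nat \<Rightarrow> real \<Rightarrow> nat" where
  "steps k t = nat \<lfloor>t * 2 ^ k\<rfloor>"

definition Euler :: "nat \<Rightarrow> real \<Rightarrow> 'a \<Rightarrow> 'a" where
  "Euler k t = J (1 / 2 ^ k) ^^ steps k t"

lemma steps_bounds:
  assumes "t \<ge> 0"
  shows "real (steps k t) \<le> t * 2 ^ k" "t * 2 ^ k < real (steps k t) + 1"
proof -
  have "real (steps k t) = \<lfloor>t * 2 ^ k\<rfloor>"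
    unfolding steps_def using assms by (subst of_nat_nat) simp_all
  then show "real (steps k t) \<le> t * 2 ^ k" "t * 2 ^ k < real (steps k t) + 1"
    by linarith+
qed

text \<open>Two errors of order 2^(-k): halving the step over the same time, and rounding, since the
  finer step count is twice the coarser one or one more.\<close>

lemma Euler_Suc:
  assumes "t \<ge> 0" "y \<in> D" "A y \<in> D"
  shows "norm (Euler (Suc k) t y - Euler k t y) \<le> (t * norm (A (A y)) + norm (A y)) * (1 / 2) ^ k"
proof -
  define h :: real where "h = 1 / 2 ^ k"
  have h: "h > 0" "h / 2 > 0" "1 / 2 ^ Suc k = h / 2"
    by (simp_all add: h_def)
  define n n' where "n = steps k t" and "n' = steps (Suc k) t"
  have n: "real n * h \<le> t"
    using steps_bounds(1)[OF assms(1), of k] by (simp add: n_def h_def field_simps)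
  have nn': "\<bar>real n' - real (2 * n)\<bar> \<le> 1"
  proof -
    \<comment> \<open>Integrality sharpens these strict bounds to n' \<le> 2 n + 1 and 2 n \<le>
      n'.\<close>
    have "real n' < real (2 * n + 2)" "real (2 * n) < real (n' + 1)"
      using steps_bounds[OF assms(1), of k] steps_bounds[OF assms(1), of "Suc k"]
      unfolding n_def n'_def power_Suc mult.left_commute[of t 2] by simp_all
    then show ?thesis
      unfolding of_nat_less_iff by linarith
  qed
  have "norm ((J (h / 2) ^^ n') y - (J (h / 2) ^^ (2 * n)) y) \<le> \<bar>real n' - real (2 * n)\<bar> * (h / 2) * norm (A y)"
    by (rule Jn_Lipschitz) (use h assms in auto)
  also have "\<dots> \<le> 1 * h * norm (A y)"
    using nn' h by (intro mult_right_mono mult_mono) auto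
  finally have 1: "norm ((J (h / 2) ^^ n') y - (J (h / 2) ^^ (2 * n)) y) \<le> h * norm (A y)"
    by simp
  have "norm ((J h ^^ n) y - (J (h / 2) ^^ (2 * n)) y) \<le> (real n * h) * (h / 4 * norm (A (A y)))"
    using Jn_halving[OF h(1) assms(2,3), of n] by (simp add: power2_eq_square mult.assoc)
  also have "\<dots> \<le> t * (h * norm (A (A y)))"
    using n h assms by (intro mult_mono mult_right_mono) auto
  finally have 2: "norm ((J h ^^ n) y - (J (h / 2) ^^ (2 * n)) y) \<le> t * h * norm (A (A y))"
    by simp
  have "norm ((J (h / 2) ^^ n') y - (J h ^^ n) y) \<le> h * norm (A y) + t * h * norm (A (A y))"
    using norm_diff_triangle_le[OF 1 2[unfolded norm_minus_commute[of "(J h ^^ n) y"]]] .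
  then show ?thesis
    unfolding Euler_def n_def[symmetric] n'_def[symmetric] h(3) h_def[symmetric]
    by (simp add: h_def algebra_simps power_one_over)
qed

lemma Euler_diff: "Euler k t (x - y) = Euler k t x - Euler k t y"
  by (simp add: Euler_def Jn_diff)

lemma Euler_norm: "norm (Euler k t x) \<le> norm x"
  by (simp add: Euler_def Jn_norm)

lemma square_domain_dense: "closure {y \<in> D. A y \<in> D} = UNIV"
proof -
  have "\<exists>v\<in>{y \<in> D. A y \<in> D}. dist v x < e" if "e > 0" for x e
  proof -
    obtain z where z: "z \<in> D" "norm (x - z) < e / 8"
      using dense_approx[OF dense, of "e / 8" x] \<open>e > 0\<close> by auto
    \<comment> \<open>Each of the two applications of \<open>J h\<close> may cost e / 2: twice e / 8
      from x - z and e / 4 from h norm (A z). The added 1 covers A z = 0.\<close>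
    define h where "h = e / (4 * (norm (A z) + 1))"
    have pos: "norm (A z) + 1 > 0"
      using norm_ge_zero[of "A z"] by linarith
    then have h: "h > 0" "h * norm (A z) \<le> e / 4"
      using \<open>e > 0\<close> by (simp_all add: h_def field_simps)
    have "J h (J h x) - x = J h (J h x - x) + (J h x - x)"
      using h by (simp add: J_diff)
    then have "norm (J h (J h x) - x) \<le> norm (J h x - x) + norm (J h x - x)"
      using J_norm[OF h(1), of "J h x - x"] by (metis norm_triangle_mono order_refl)
    moreover have "norm (J h x - x) \<le> 2 * norm (x - z) + h * norm (A z)"
      using Jn_near_approx[OF h(1) z(1), of 1 x] by simp
    ultimately have "dist (J h (J h x)) x < e"
      using z h by (simp add: dist_norm)
    then show ?thesis
      using h by (intro bexI[of _ "J h (J h x)"]) (auto simp: J_in_D J_A)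
  qed
  then show ?thesis
    by (auto simp: closure_approachable)
qed

text \<open>On D(A^2) the increments in k have a geometric majorant; contractivity extends
  convergence to all vectors.\<close>

lemma Euler_convergent:
  assumes "t \<ge> 0"
  shows "convergent (\<lambda>k. Euler k t x)"
proof (rule convergent_on_dense[OF square_domain_dense])
  fix y
  assume "y \<in> {y \<in> D. A y \<in> D}"
  then have y: "y \<in> D" "A y \<in> D" by auto
  let ?C = "t * norm (A (A y)) + norm (A y)"
  have "summable (\<lambda>k. Euler (Suc k) t y - Euler k t y)"
    by (rule summable_comparison_test'[where g="\<lambda>k. ?C * (1 / 2) ^ k" and N=0])
      (use Euler_Suc[OF assms y] in \<open>auto intro!: summable_mult summable_geometric\<close>)
  then have "convergent (\<lambda>n. Euler n t y - Euler 0 t y)"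
    by (simp add: summable_iff_convergent sum_lessThan_telescope[of "\<lambda>k. Euler k t y"])
  from convergent_add[OF this convergent_const[of "Euler 0 t y"]]
  show "convergent (\<lambda>n. Euler n t y)"
    by simp
qed (simp_all add: Euler_diff Euler_norm)

section \<open>The limit semigroup and its generator\<close>

definition T :: "real \<Rightarrow> 'a \<Rightarrow> 'a" where
  "T t x = lim (\<lambda>k. Euler k t x)"

lemma Euler_tendsto: "t \<ge> 0 \<Longrightarrow> (\<lambda>k. Euler k t x) \<longlonglongrightarrow> T t x"
  unfolding T_def using Euler_convergent by (simp add: convergent_LIMSEQ_iff)

lemma T_norm:
  assumes "t \<ge> 0"
  shows "norm (T t x) \<le> norm x"
  by (rule LIMSEQ_le_const2[OF tendsto_norm[OF Euler_tendsto[OF assms]]]) (auto simp: Euler_norm)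

lemma T_bounded_operator:
  assumes "t \<ge> 0"
  shows "bounded_operator (T t)"
proof -
  have Eop: "bounded_operator (Euler k t)" for k
    by (simp add: Euler_def Jn_bounded_operator)
  have scale: "T t (c *\<^sub>C x) = c *\<^sub>C T t x" for c x
  proof (rule LIMSEQ_unique[OF Euler_tendsto[OF assms]])
    have "(\<lambda>k. c *\<^sub>C Euler k t x) \<longlonglongrightarrow> c *\<^sub>C T t x"
      by (rule bounded_linear.tendsto[OF bounded_linear_scaleC Euler_tendsto[OF assms]])
    then show "(\<lambda>k. Euler k t (c *\<^sub>C x)) \<longlonglongrightarrow> c *\<^sub>C T t x"
      using Eop by (simp add: bounded_operator_def)
  qed
  have add: "T t (x + y) = T t x + T t y" for x y
  proof (rule LIMSEQ_unique[OF Euler_tendsto[OF assms]])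
    have "(\<lambda>k. Euler k t x + Euler k t y) \<longlonglongrightarrow> T t x + T t y"
      by (intro tendsto_add Euler_tendsto assms)
    then show "(\<lambda>k. Euler k t (x + y)) \<longlonglongrightarrow> T t x + T t y"
      using Eop by (simp add: bounded_operator_def linear_add[OF bounded_linear.linear])
  qed
  have "bounded_linear (T t)"
    by (rule bounded_linear_intro[where K=1])
      (use T_norm[OF assms] in \<open>auto simp: add scale scaleR_scaleC\<close>)
  then show ?thesis
    by (simp add: bounded_operator_def scale)
qed

lemma T_diff: "t \<ge> 0 \<Longrightarrow> T t (x - y) = T t x - T t y"
  using T_bounded_operator by (simp add: bounded_operator_def linear_diff[OF bounded_linear.linear])

lemma tendsto_dyadic: "(\<lambda>k. c * (1 / 2 ^ k)) \<longlonglongrightarrow> (0::real)"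
  using tendsto_mult_right_zero[OF LIMSEQ_power_zero[of "1 / 2 :: real"], of c] by (simp add: power_one_over)

text \<open>The step count for s + t and the sum of the counts for s and t differ by at most one,
  which costs at most norm (A y) / 2^k for y in D.\<close>

lemma T_plus:
  assumes "s \<ge> 0" "t \<ge> 0"
  shows "T (s + t) x = T s (T t x)"
proof (rule eq_on_dense[OF dense, where f="T (s + t)" and g="\<lambda>x. T s (T t x)"])
  show "continuous_on UNIV (T (s + t))" "continuous_on UNIV (\<lambda>x. T s (T t x))"
    using T_bounded_operator[of s] T_bounded_operator[of t] T_bounded_operator[of "s + t"] assms
    by (auto simp: bounded_operator_def intro: linear_continuous_on bounded_linear_compose)
next
  fix y
  assume "y \<in> D"
  \<comment> \<open>Contractivity of \<open>Euler k s\<close> lets the inner approximation be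
    replaced by its limit.\<close>
  have "(\<lambda>k. Euler k s (Euler k t y - T t y)) \<longlonglongrightarrow> 0"
  proof (rule Lim_null_comparison)
    show "\<forall>\<^sub>F k in sequentially. norm (Euler k s (Euler k t y - T t y)) \<le> norm (Euler k t y - T t y)"
      by (simp add: Euler_norm)
    show "(\<lambda>k. norm (Euler k t y - T t y)) \<longlonglongrightarrow> 0"
      using Euler_tendsto[OF assms(2), of y] by (intro tendsto_norm_zero) (simp add: Lim_null[symmetric])
  qed
  from tendsto_add[OF this Euler_tendsto[OF assms(1), of "T t y"]]
  have 1: "(\<lambda>k. Euler k s (Euler k t y)) \<longlonglongrightarrow> T s (T t y)"
    by (simp add: Euler_diff)
  have "(\<lambda>k. Euler k (s + t) y - Euler k s (Euler k t y)) \<longlonglongrightarrow> 0"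
  proof (rule Lim_null_comparison)
    have "norm (Euler k (s + t) y - Euler k s (Euler k t y)) \<le> norm (A y) * (1 / 2 ^ k)" for k
    proof -
      have "\<bar>real (steps k (s + t)) - real (steps k s + steps k t)\<bar> \<le> 1"
      proof -
        have "real (steps k (s + t)) < real (steps k s + steps k t + 2)"
          "real (steps k s + steps k t) < real (steps k (s + t) + 1)"
          using steps_bounds[of s k] steps_bounds[of t k] steps_bounds[of "s + t" k] assms
          by (simp_all add: distrib_right)
        then show ?thesis
          unfolding of_nat_less_iff by linarith
      qed
      then have "\<bar>real (steps k (s + t)) - real (steps k s + steps k t)\<bar> * (1 / 2 ^ k) * norm (A y)
          \<le> 1 * (1 / 2 ^ k) * norm (A y)"
        by (intro mult_right_mono) auto
      moreover have "Euler k s (Euler k t y) = (J (1 / 2 ^ k) ^^ (steps k s + steps k t)) y"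
        by (simp add: Euler_def funpow_add)
      ultimately show ?thesis
        using Jn_Lipschitz[of "1 / 2 ^ k" y "steps k (s + t)" "steps k s + steps k t"] \<open>y \<in> D\<close>
        by (simp add: Euler_def)
    qed
    then show "\<forall>\<^sub>F k in sequentially. norm (Euler k (s + t) y - Euler k s (Euler k t y)) \<le> norm (A y) * (1 / 2 ^ k)"
      by simp
  qed (rule tendsto_dyadic)
  from tendsto_add[OF this 1] have "(\<lambda>k. Euler k (s + t) y) \<longlonglongrightarrow> T s (T t y)"
    by simp
  then show "T (s + t) y = T s (T t y)"
    using assms by (intro LIMSEQ_unique[OF Euler_tendsto]) simp_all
qed

lemma T_Lipschitz:
  assumes "s \<ge> 0" "t \<ge> 0" "y \<in> D"
  shows "norm (T s y - T t y) \<le> \<bar>s - t\<bar> * norm (A y)"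
proof (rule LIMSEQ_le)
  show "(\<lambda>k. norm (Euler k s y - Euler k t y)) \<longlonglongrightarrow> norm (T s y - T t y)"
    by (intro tendsto_intros Euler_tendsto assms)
  show "(\<lambda>k. \<bar>s - t\<bar> * norm (A y) + norm (A y) * (1 / 2 ^ k)) \<longlonglongrightarrow> \<bar>s - t\<bar> * norm (A y)"
    using tendsto_add[OF tendsto_const tendsto_dyadic, of "\<bar>s - t\<bar> * norm (A y)" "norm (A y)"] by simp
  have "norm (Euler k s y - Euler k t y) \<le> \<bar>s - t\<bar> * norm (A y) + norm (A y) * (1 / 2 ^ k)" for k
  proof -
    have "\<bar>real (steps k s) - real (steps k t)\<bar> \<le> \<bar>s * 2 ^ k - t * 2 ^ k\<bar> + 1"
      using steps_bounds[OF assms(1), of k] steps_bounds[OF assms(2), of k] by linarith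
    also have "\<dots> = \<bar>s - t\<bar> * 2 ^ k + 1"
      by (simp add: left_diff_distrib[symmetric] abs_mult)
    finally have "\<bar>real (steps k s) - real (steps k t)\<bar> * (1 / 2 ^ k) * norm (A y)
        \<le> (\<bar>s - t\<bar> * 2 ^ k + 1) * (1 / 2 ^ k) * norm (A y)"
      by (intro mult_right_mono) auto
    then show ?thesis
      using Jn_Lipschitz[of "1 / 2 ^ k" y "steps k s" "steps k t"] \<open>y \<in> D\<close>
      by (simp add: Euler_def algebra_simps add_divide_distrib)
  qed
  then show "\<exists>N. \<forall>k\<ge>N. norm (Euler k s y - Euler k t y) \<le> \<bar>s - t\<bar> * norm (A y) + norm (A y) * (1 / 2 ^ k)"
    by blast
qed

lemma T_continuous: "continuous_on {0..} (\<lambda>t. T t x)"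
  unfolding continuous_on_iff
proof (intro ballI allI impI)
  fix t e :: real
  assume "t \<in> {0..}" "e > 0"
  obtain y where y: "y \<in> D" "norm (x - y) < e / 4"
    using dense_approx[OF dense, of "e / 4" x] \<open>e > 0\<close> by auto
  have pos: "norm (A y) + 1 > 0"
    using norm_ge_zero[of "A y"] by linarith
  define d where "d = e / (2 * (norm (A y) + 1))"
  have d: "d > 0" "d * norm (A y) \<le> e / 2"
    using pos \<open>e > 0\<close> by (simp_all add: d_def field_simps)
  have "dist (T s x) (T t x) < e" if "s \<in> {0..}" "dist s t < d" for s
  proof -
    have "dist (T r x) (T r y) < e / 4" if "r \<ge> 0" for r
      using T_norm[OF that, of "x - y"] y(2) by (simp add: T_diff that dist_norm)
    note this[of s] this[of t]
    moreover have "dist (T s y) (T t y) \<le> d * norm (A y)"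
      using T_Lipschitz[of s t y] \<open>t \<in> {0..}\<close> that y(1)
      by (auto simp: dist_norm intro: order_trans[OF _ mult_right_mono])
    ultimately show ?thesis
      using d(2) \<open>t \<in> {0..}\<close> \<open>s \<in> {0..}\<close> dist_triangle[of "T s x" "T t x" "T s y"]
        dist_triangle[of "T s y" "T t x" "T t y"] by (simp add: dist_commute)
  qed
  then show "\<exists>d>0. \<forall>s\<in>{0..}. dist s t < d \<longrightarrow> dist (T s x) (T t x) < e"
    using d(1) by blast
qed

text \<open>The limit of \<open>Jn_first_order\<close>; \<open>r k\<close> is the time that the k-th
  scheme really covers.\<close>

lemma T_first_order:
  assumes "t \<ge> 0" "y \<in> D" "z \<in> D"
  shows "norm (T t y - y - t *\<^sub>R A y) \<le> t * (2 * norm (A y - z) + t * norm (A z))"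
proof (rule LIMSEQ_le)
  define r where "r k = real (steps k t) * (1 / 2 ^ k)" for k
  have r: "r \<longlonglongrightarrow> t"
  proof (rule tendsto_sandwich)
    show "(\<lambda>k. t - 1 * (1 / 2 ^ k)) \<longlonglongrightarrow> t"
      using tendsto_diff[OF tendsto_const tendsto_dyadic, of t 1] by simp
    have "(t * 2 ^ k - 1) / 2 ^ k \<le> real (steps k t) / 2 ^ k" "real (steps k t) / 2 ^ k \<le> t * 2 ^ k / 2 ^ k" for k
      using steps_bounds[OF assms(1), of k] by (intro divide_right_mono; simp)+
    then show "\<forall>\<^sub>F k in sequentially. t - 1 * (1 / 2 ^ k) \<le> r k" "\<forall>\<^sub>F k in sequentially. r k \<le> t"
      by (simp_all add: r_def diff_divide_distrib)
  qed simp
  show "(\<lambda>k. norm (Euler k t y - y - r k *\<^sub>R A y)) \<longlonglongrightarrow> norm (T t y - y - t *\<^sub>R A y)"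
    by (intro tendsto_intros Euler_tendsto assms r)
  show "(\<lambda>k. r k * (2 * norm (A y - z) + r k * norm (A z)))
      \<longlonglongrightarrow> t * (2 * norm (A y - z) + t * norm (A z))"
    by (intro tendsto_intros r)
  show "\<exists>N. \<forall>k\<ge>N. norm (Euler k t y - y - r k *\<^sub>R A y) \<le> r k * (2 * norm (A y - z) + r k * norm (A z))"
    using Jn_first_order[OF _ assms(2,3), of "1 / 2 ^ _"] unfolding r_def Euler_def by simp
qed

lemma T_right_derivative:
  assumes "y \<in> D"
  shows "((\<lambda>t. (T t y - y) /\<^sub>R t) \<longlongrightarrow> A y) (at_right 0)"
  unfolding tendsto_iff
proof (intro allI impI)
  fix e :: real
  assume "e > 0"
  \<comment> \<open>z is fixed before t: first 2 norm (A y - z) is made small, then t norm (A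
    z).\<close>
  obtain z where z: "z \<in> D" "norm (A y - z) < e / 4"
    using dense_approx[OF dense, of "e / 4" "A y"] \<open>e > 0\<close> by auto
  have pos: "norm (A z) + 1 > 0"
    using norm_ge_zero[of "A z"] by linarith
  define d where "d = e / (2 * (norm (A z) + 1))"
  have d: "d > 0" "d * norm (A z) \<le> e / 2"
    using pos \<open>e > 0\<close> by (simp_all add: d_def field_simps)
  have "dist ((T t y - y) /\<^sub>R t) (A y) < e" if "0 < t" "t < d" for t
  proof -
    have "(T t y - y) /\<^sub>R t - A y = (T t y - y - t *\<^sub>R A y) /\<^sub>R t"
      using that by (simp add: scaleR_diff_right)
    then have "dist ((T t y - y) /\<^sub>R t) (A y) = norm (T t y - y - t *\<^sub>R A y) / t"
      using that by (simp add: dist_norm divide_inverse mult.commute)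
    also have "\<dots> \<le> 2 * norm (A y - z) + t * norm (A z)"
      using T_first_order[OF _ assms z(1), of t] that by (simp add: pos_divide_le_eq mult.commute)
    also have "t * norm (A z) \<le> d * norm (A z)"
      using that by (intro mult_right_mono) auto
    finally show ?thesis
      using z(2) d(2) by simp
  qed
  then show "\<forall>\<^sub>F t in at_right 0. dist ((T t y - y) /\<^sub>R t) (A y) < e"
    unfolding eventually_at_right_field using d(1) by blast
qed

text \<open>The generator extends A; it must be shown not to be larger. As 1 - A is onto, a vector y
  with limit l differs from some z in D by a vector d whose derivative at 0 is d itself, and
  contractivity forces Re <d, d> \<le> 0.\<close>

lemma T_generator: "is_generator T D A"
proof -
  have "y \<in> D" if lim: "((\<lambda>t. (T t y - y) /\<^sub>R t) \<longlongrightarrow> l) (at_right 0)" for y l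
  proof -
    have "y - l \<in> (\<lambda>y. y - 1 *\<^sub>R A y) ` D"
      unfolding surj[OF zero_less_one] by simp
    then obtain z where z: "z \<in> D" "y - l = z - 1 *\<^sub>R A z"
      by blast
    define d where "d = y - z"
    have "((\<lambda>t. (T t y - y) /\<^sub>R t - (T t z - z) /\<^sub>R t) \<longlongrightarrow> l - A z) (at_right 0)"
      by (intro tendsto_diff lim T_right_derivative z)
    moreover have "\<forall>\<^sub>F t in at_right 0. (T t y - y) /\<^sub>R t - (T t z - z) /\<^sub>R t = (T t d - d) /\<^sub>R t"
      by (auto simp: eventually_at_filter d_def T_diff algebra_simps intro!: always_eventually)
    moreover have eq: "l - A z = d"
      using z(2) unfolding d_def by (simp add: algebra_simps)
    ultimately have "((\<lambda>t. (T t d - d) /\<^sub>R t) \<longlongrightarrow> d) (at_right 0)"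
      unfolding eq by (simp cong: tendsto_cong)
    then have "((\<lambda>t. Re (cinner ((T t d - d) /\<^sub>R t) d)) \<longlongrightarrow> Re (cinner d d)) (at_right 0)"
      by (intro bounded_bilinear.tendsto[OF bounded_bilinear_Re_cinner] tendsto_const)
    moreover have "\<forall>\<^sub>F t in at_right 0. Re (cinner ((T t d - d) /\<^sub>R t) d) \<le> 0"
    proof -
      have "Re (cinner (T t d) d) \<le> Re (cinner d d)" if "t > 0" for t
        using Re_cinner_le[of "T t d" d] mult_right_mono[OF T_norm[of t d] norm_ge_zero[of d]] that
        by (simp add: Re_cinner_self power2_eq_square)
      then show ?thesis
        by (auto simp: eventually_at_filter Re_cinner_simps mult_nonneg_nonpos intro!: always_eventually)
    qed
    ultimately have "Re (cinner d d) \<le> 0"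
      by (rule tendsto_upperbound) simp
    then have "y = z"
      by (simp add: Re_cinner_self d_def)
    then show ?thesis
      using z(1) by simp
  qed
  then show ?thesis
    unfolding is_generator_def using T_right_derivative by blast
qed

lemma semigroup_generator: "semigroup_generator T D A"
proof
  have "T 0 x = x" for x
    using LIMSEQ_unique[OF Euler_tendsto[of 0 x]] by (simp add: Euler_def steps_def)
  then show "C0_semigroup T"
    unfolding C0_semigroup_def
    by (auto simp: T_bounded_operator T_plus T_continuous fun_eq_iff)
  show "\<exists>M\<ge>0. \<forall>t\<in>{0..N}. \<forall>x. norm (T t x) \<le> M * norm x" for N
    using T_norm by (intro exI[of _ 1]) auto
qed (rule T_generator lin)+

end

lemma quasidissipative_generates:
  assumes lin: "linear_operator D A" and dense: "densely_defined D" and bound: "numerical_bound w D A"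
    and "\<mu> > w" and surj: "(\<lambda>y. \<mu> *\<^sub>R y - A y) ` D = UNIV"
  shows "\<exists>T. semigroup_generator T D A"
proof -
  interpret dissipative_operator D "\<lambda>y. A y - w *\<^sub>R y"
  proof
    show "linear_operator D (\<lambda>y. A y - w *\<^sub>R y)"
      using linear_operator_scaleR_diff[OF linear_operator_scaleR_diff[OF lin, of w 1], of 0 1] by simp
    show "closure D = UNIV"
      using dense by (simp add: densely_defined_def)
    show "Re (cinner (A y - w *\<^sub>R y) y) \<le> 0" if "y \<in> D" for y
      using bound that by (simp add: numerical_bound_def Re_cinner_simps Re_cinner_self)
    show "\<exists>\<nu>>0. (\<lambda>y. \<nu> *\<^sub>R y - (A y - w *\<^sub>R y)) ` D = UNIV"
      using surj \<open>\<mu> > w\<close> by (intro exI[of _ "\<mu> - w"]) (simp add: algebra_simps)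
  qed
  show ?thesis
    using semigroup_generator.rescaled_semigroup_generator[OF semigroup_generator, of w] by auto
qed

section \<open>Quasicontractive semigroups\<close>

context semigroup_generator
begin

lemma cinner_orbit_derivative:
  assumes "y \<in> D" "z \<in> D" "t \<ge> 0"
  shows "((\<lambda>t. Re (cinner (T t y) (T t z))) has_real_derivative
    Re (cinner (T t y) (T t (A z))) + Re (cinner (T t (A y)) (T t z))) (at t within {0..})"
  unfolding has_real_derivative_iff_has_vector_derivative
  by (intro bounded_bilinear.has_vector_derivative[OF bounded_bilinear_Re_cinner] orbit_derivative assms)

lemma norm_orbit_derivative:
  assumes "y \<in> D" "t \<ge> 0"
  shows "((\<lambda>t. (norm (T t y))\<^sup>2) has_real_derivative 2 * Re (cinner (A (T t y)) (T t y))) (at t within {0..})"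
  using cinner_orbit_derivative[OF assms(1,1,2)] Re_cinner_commute[of "T t y" "T t (A y)"]
  by (simp add: Re_cinner_self T_invariant assms)

text \<open>Dissipativity makes the squared norm nonincreasing along orbits in D, and density does
  the rest. Conversely Re <T t y - y, y> \<le> 0 by Cauchy-Schwarz; divide by t and let t tend to
  0.\<close>

lemma dissipative_iff_contractive:
  "(\<forall>y\<in>D. Re (cinner (A y) y) \<le> 0) \<longleftrightarrow> (\<forall>t\<ge>0. \<forall>x. norm (T t x) \<le> norm x)"
proof (intro iffI ballI allI impI)
  fix t :: real and x
  assume diss: "\<forall>y\<in>D. Re (cinner (A y) y) \<le> 0" and "t \<ge> 0"
  have "norm (T t y) \<le> norm y" if "y \<in> D" for y
  proof (cases "t = 0")
    case False
    then have "\<exists>s\<in>{0<..<t}. (norm (T t y))\<^sup>2 - (norm (T 0 y))\<^sup>2 = 2 * Re (cinner (A (T s y)) (T s y)) * (t - 0)"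
      using \<open>t \<ge> 0\<close> that
      by (intro mvt_simple has_derivative_subset[OF norm_orbit_derivative[unfolded has_field_derivative_def]]) auto
    then obtain s where s: "s > 0" "(norm (T t y))\<^sup>2 - (norm y)\<^sup>2 = 2 * Re (cinner (A (T s y)) (T s y)) * t"
      by auto
    have "Re (cinner (A (T s y)) (T s y)) \<le> 0"
      using diss T_invariant(1)[OF that] s(1) by simp
    then have "(norm (T t y))\<^sup>2 \<le> (norm y)\<^sup>2"
      using s(2) \<open>t \<ge> 0\<close> mult_nonpos_nonneg[of "2 * Re (cinner (A (T s y)) (T s y))" t] by linarith
    then show ?thesis
      by (rule power2_le_imp_le) simp
  qed simp
  moreover have "closed {x. norm (T t x) \<le> norm x}"
    using T_bounded_linear[OF \<open>t \<ge> 0\<close>]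
    by (intro closed_Collect_le continuous_on_norm linear_continuous_on continuous_on_id)
  ultimately have "closure D \<subseteq> {x. norm (T t x) \<le> norm x}"
    by (intro closure_minimal) auto
  then show "norm (T t x) \<le> norm x"
    by (auto simp: domain_dense)
next
  fix y
  assume contr: "\<forall>t\<ge>0. \<forall>x. norm (T t x) \<le> norm x" and "y \<in> D"
  have "((\<lambda>t. Re (cinner ((T t y - y) /\<^sub>R t) y)) \<longlongrightarrow> Re (cinner (A y) y)) (at_right 0)"
    by (intro bounded_bilinear.tendsto[OF bounded_bilinear_Re_cinner] tendsto_const generatorD[OF gen \<open>y \<in> D\<close>])
  moreover have "\<forall>\<^sub>F t in at_right 0. Re (cinner ((T t y - y) /\<^sub>R t) y) \<le> 0"
  proof -
    have "Re (cinner (T t y) y) \<le> Re (cinner y y)" if "t > 0" for t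
      using Re_cinner_le[of "T t y" y] mult_right_mono[OF _ norm_ge_zero[of y], of "norm (T t y)" "norm y"]
        contr that by (simp add: Re_cinner_self power2_eq_square)
    then show ?thesis
      by (auto simp: eventually_at_filter Re_cinner_simps mult_nonneg_nonpos intro!: always_eventually)
  qed
  ultimately show "Re (cinner (A y) y) \<le> 0"
    by (rule tendsto_upperbound) simp
qed

lemma numerical_bound_iff_quasicontractive: "numerical_bound w D A \<longleftrightarrow> quasicontractive w T"
proof -
  interpret S: semigroup_generator "rescaled (- w) T" D "\<lambda>y. A y + (- w) *\<^sub>R y"
    by (rule rescaled_semigroup_generator)
  have "numerical_bound w D A \<longleftrightarrow> (\<forall>t\<ge>0. \<forall>x. norm (rescaled (- w) T t x) \<le> norm x)"
    unfolding S.dissipative_iff_contractive[symmetric] numerical_bound_def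
    by (simp add: Re_cinner_simps Re_cinner_self)
  also have "\<dots> \<longleftrightarrow> (\<forall>t\<ge>0. \<forall>x. norm (T t x) \<le> exp (w * t) * norm x)"
    by (simp add: rescaled_def exp_minus field_simps)
  also have "\<dots> \<longleftrightarrow> (\<forall>t\<ge>0. onorm (T t) \<le> exp (w * t))"
  proof (intro iffI allI impI)
    fix t :: real and x
    assume "\<forall>t\<ge>0. onorm (T t) \<le> exp (w * t)" "t \<ge> 0"
    then show "norm (T t x) \<le> exp (w * t) * norm x"
      by (meson T_bounded_linear mult_right_mono norm_ge_zero onorm order_trans)
  qed (auto intro: onorm_bound)
  finally show ?thesis
    by (simp add: quasicontractive_def C0)
qed

end

text \<open>With R the inverse of \<mu> - A, the graph of A is the solution set of R (\<mu> y - z) =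
  y, an equation between continuous functions of (y, z).\<close>

lemma invertible_operator_imp_closed:
  assumes "invertible_operator D (\<lambda>y. \<mu> *\<^sub>R y - A y)"
  shows "closed_operator D A"
proof -
  obtain R where R: "bounded_linear R" "\<And>x. R x \<in> D" "\<And>x. \<mu> *\<^sub>R R x - A (R x) = x"
    "\<And>y. y \<in> D \<Longrightarrow> R (\<mu> *\<^sub>R y - A y) = y"
    using assms unfolding invertible_operator_def bounded_operator_def by blast
  have graph: "y \<in> D \<and> z = A y" if "R (\<mu> *\<^sub>R y - z) = y" for y z
    using R(2,3)[of "\<mu> *\<^sub>R y - z"] unfolding that by simp
  have "{(y, A y) | y. y \<in> D} = {p. R (\<mu> *\<^sub>R fst p - snd p) = fst p}"
    by (auto simp: R(4) dest: graph)
  moreover have "closed {p. R (\<mu> *\<^sub>R fst p - snd p) = fst p}"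
    by (intro closed_Collect_eq bounded_linear.continuous_on[OF R(1)] continuous_intros)
  ultimately show ?thesis
    by (simp add: closed_operator_def)
qed

section \<open>The skew sums as derivatives\<close>

definition skew_sum :: "nat \<Rightarrow> ('a::complex_hilbert_space \<Rightarrow> 'a) \<Rightarrow> 'a \<Rightarrow> real" where
  "skew_sum m A y = (\<Sum>k\<le>m. real (m choose k) * Re (cinner ((A ^^ k) y) ((A ^^ (m - k)) y)))"

text \<open>The complex sum is invariant under conjugation, by the symmetry of the binomial coefficients.\<close>

lemma m_skew_symmetric_iff:
  "m_skew_symmetric m D A \<longleftrightarrow> (\<forall>y\<in>power_domain D A m. skew_sum m A y = 0)"
proof -
  have "(\<Sum>k\<le>m. of_nat (m choose k) * cinner ((A ^^ k) y) ((A ^^ (m - k)) y)) =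
      complex_of_real (skew_sum m A y)" (is "?S = _") for y
  proof -
    have "cnj ?S = (\<Sum>k\<le>m. of_nat (m choose k) * cinner ((A ^^ (m - k)) y) ((A ^^ k) y))"
      by (simp add: cinner_commute[symmetric])
    also have "\<dots> = ?S"
      by (rule sum.reindex_bij_witness[where i="\<lambda>k. m - k" and j="\<lambda>k. m - k"])
        (auto simp: binomial_symmetric[symmetric])
    finally have "Im ?S = 0"
      by (simp only: Reals_cnj_iff flip: complex_is_Real_iff)
    moreover have "Re ?S = skew_sum m A y"
      by (simp add: skew_sum_def)
    ultimately show ?thesis
      by (simp add: complex_eq_iff)
  qed
  then show ?thesis
    by (simp add: m_skew_symmetric_def)
qed

lemma power_domain_funpow: "y \<in> power_domain D A m \<Longrightarrow> k < m \<Longrightarrow> (A ^^ k) y \<in> D"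
proof (induction m arbitrary: y k)
  case (Suc m)
  then show ?case
    by (cases k) (simp_all add: funpow_Suc_right del: funpow.simps(2))
qed simp

context semigroup_generator
begin

text \<open>For y in D(A^n) this is the n-th derivative of the squared norm of T t y, by the Leibniz
  rule. The powers of A stand inside \<open>T t\<close>, so the sum is continuous in t for every
  y.\<close>

definition skew_orbit :: "'a \<Rightarrow> nat \<Rightarrow> real \<Rightarrow> real" where
  "skew_orbit y n t =
    (\<Sum>k\<le>n. real (n choose k) * Re (cinner (T t ((A ^^ k) y)) (T t ((A ^^ (n - k)) y))))"

lemma skew_orbit_0: "skew_orbit y 0 t = (norm (T t y))\<^sup>2"
  by (simp add: skew_orbit_def Re_cinner_self)

lemma skew_orbit_eq: "y \<in> power_domain D A m \<Longrightarrow> t \<ge> 0 \<Longrightarrow> skew_orbit y m t = skew_sum m A (T t y)"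
  by (simp add: skew_orbit_def skew_sum_def funpow_invariant)

lemma skew_orbit_continuous: "continuous_on {0..} (skew_orbit y n)"
  unfolding skew_orbit_def
  by (intro continuous_intros bounded_bilinear.continuous_on[OF bounded_bilinear_Re_cinner] orbit_continuous)

lemma skew_orbit_derivative:
  assumes "y \<in> power_domain D A m" "n < m" "t \<ge> 0"
  shows "(skew_orbit y n has_real_derivative skew_orbit y (Suc n) t) (at t within {0..})"
proof -
  let ?u = "\<lambda>k. T t ((A ^^ k) y)"
  have "(skew_orbit y n has_real_derivative
      (\<Sum>k\<le>n. real (n choose k) * (Re (cinner (?u k) (?u (Suc (n - k)))) + Re (cinner (?u (Suc k)) (?u (n - k))))))
      (at t within {0..})"
    unfolding skew_orbit_def funpow.simps o_apply using assms
    by (intro DERIV_sum DERIV_cmult cinner_orbit_derivative power_domain_funpow) auto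
  also have "(\<Sum>k\<le>n. real (n choose k) * (Re (cinner (?u k) (?u (Suc (n - k)))) + Re (cinner (?u (Suc k)) (?u (n - k)))))
      = skew_orbit y (Suc n) t"
    unfolding skew_orbit_def sum_Suc_choose
    by (simp add: distrib_left sum.distrib Suc_diff_le)
  finally show ?thesis .
qed

text \<open>The hinge between m-isometry and (iv): by \<open>skew_orbit_eq\<close> the value on the
  right is \<open>skew_sum\<close> at a point of the orbit.\<close>

lemma fdiff_norm_orbit:
  assumes "y \<in> power_domain D A m" "h > 0" "s \<ge> 0"
  shows "\<exists>\<xi>. s \<le> \<xi> \<and> \<xi> \<le> s + real m * h \<and>
    (fdiff ^^ m) (\<lambda>k. (norm (T (s + real k * h) y))\<^sup>2) 0 = h ^ m * skew_orbit y m \<xi>"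
  using fdiff_mean_value[where F="skew_orbit y" and m=m, OF skew_orbit_derivative[OF assms(1)] assms(2,3)]
  by (simp add: skew_orbit_0)

lemma T_funpow:
  assumes "h \<ge> 0" "s \<ge> 0"
  shows "(T h ^^ k) (T s x) = T (s + real k * h) x"
proof (induction k)
  case (Suc k)
  have "T h (T (s + real k * h) x) = T (h + (s + real k * h)) x"
    using assms by (intro T_plus[symmetric]) auto
  then show ?case
    using Suc.IH by (simp add: algebra_simps)
qed simp

lemma m_isometric_iff:
  assumes "h \<ge> 0"
  shows "m_isometric m (T h) \<longleftrightarrow> (\<forall>x. (fdiff ^^ m) (\<lambda>k. (norm (T (real k * h) x))\<^sup>2) 0 = 0)"
  using T_bounded_operator[OF assms] T_funpow[OF assms, of 0]
  by (simp add: m_isometric_def fdiff_funpow)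

text \<open>With step 1 / (n + 1) the intermediate times are at most m times the step. They shrink
  to 0, where the m-th derivative is the skew sum at y itself.\<close>

lemma m_isometric_imp_m_skew_symmetric:
  assumes "\<And>t. t \<ge> 0 \<Longrightarrow> m_isometric m (T t)"
  shows "m_skew_symmetric m D A"
  unfolding m_skew_symmetric_iff
proof
  fix y
  assume y: "y \<in> power_domain D A m"
  have "\<exists>\<xi>. 0 \<le> \<xi> \<and> \<xi> \<le> real m * inverse (real (Suc n)) \<and> skew_orbit y m \<xi> = 0" for n
    using fdiff_norm_orbit[OF y, of "inverse (real (Suc n))" 0]
      assms[of "inverse (real (Suc n))"] m_isometric_iff[of "inverse (real (Suc n))" m]
    by (auto simp del: of_nat_Suc)
  then obtain \<xi> where \<xi>: "\<And>n. 0 \<le> \<xi> n" "\<And>n. \<xi> n \<le> real m * inverse (real (Suc n))"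
    "\<And>n. skew_orbit y m (\<xi> n) = 0"
    by metis
  have "\<xi> \<longlonglongrightarrow> 0"
    by (rule tendsto_sandwich[OF _ _ tendsto_const
          tendsto_mult_right_zero[OF LIMSEQ_inverse_real_of_nat, of "real m"]])
      (intro always_eventually allI \<xi>)+
  then have "(\<lambda>n. skew_orbit y m (\<xi> n)) \<longlonglongrightarrow> skew_orbit y m 0"
    using \<xi>(1) by (intro continuous_on_tendsto_compose[OF skew_orbit_continuous]) auto
  then show "skew_sum m A y = 0"
    using skew_orbit_eq[OF y, of 0] \<xi>(3) by (simp add: LIMSEQ_const_iff)
qed

text \<open>D(A^m) is invariant under the semigroup, so the skew sum vanishes along the whole orbit,
  whatever the intermediate time is. Density covers the remaining vectors.\<close>

lemma m_skew_symmetric_imp_m_isometric: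
  assumes "m_skew_symmetric m D A" "m \<ge> 1" "h \<ge> 0"
  shows "m_isometric m (T h)"
  unfolding m_isometric_iff[OF \<open>h \<ge> 0\<close>]
proof
  fix x
  have const: "(fdiff ^^ Suc n) (\<lambda>_. c) j = 0" for n c j
  proof (induction n arbitrary: j)
    case 0
    show ?case by (simp add: fdiff_def)
  next
    case (Suc n)
    show ?case unfolding fdiff_funpow_Suc[of "Suc n"] Suc.IH by simp
  qed
  show "(fdiff ^^ m) (\<lambda>k. (norm (T (real k * h) x))\<^sup>2) 0 = 0"
  proof (rule eq_on_dense[OF power_domain_dense[of m],
        where f="\<lambda>x. (fdiff ^^ m) (\<lambda>k. (norm (T (real k * h) x))\<^sup>2) 0" and g="\<lambda>_. 0"])
    show "continuous_on UNIV (\<lambda>x. (fdiff ^^ m) (\<lambda>k. (norm (T (real k * h) x))\<^sup>2) 0)"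
      unfolding fdiff_funpow using T_bounded_linear \<open>h \<ge> 0\<close>
      by (intro continuous_intros linear_continuous_on) auto
    show "(fdiff ^^ m) (\<lambda>k. (norm (T (real k * h) y))\<^sup>2) 0 = 0" if y: "y \<in> power_domain D A m" for y
    proof (cases "h = 0")
      \<comment> \<open>All samples coincide, and the m-th difference of a constant is 0 because m
        \<ge> 1.\<close>
      case True
      then show ?thesis
        using const[of "m - 1"] \<open>m \<ge> 1\<close> by simp
    next
      case False
      then obtain \<xi> where "0 \<le> \<xi>"
        "(fdiff ^^ m) (\<lambda>k. (norm (T (real k * h) y))\<^sup>2) 0 = h ^ m * skew_orbit y m \<xi>"
        using fdiff_norm_orbit[OF y, of h 0] \<open>h \<ge> 0\<close> by auto
      then show ?thesis
        using assms(1) funpow_invariant(1)[OF y] by (simp add: skew_orbit_eq[OF y] m_skew_symmetric_iff)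
    qed
  qed simp
qed

end

section \<open>m-isometric semigroups\<close>

lemma fdiff_bound:
  assumes "\<And>k. \<bar>g k\<bar> \<le> b k * c"
  shows "\<bar>(fdiff ^^ i) g 0\<bar> \<le> (\<Sum>k\<le>i. real (i choose k) * b k) * c"
  unfolding fdiff_funpow sum_distrib_right
  using assms by (intro order_trans[OF sum_abs] sum_mono) (auto simp: abs_mult mult.assoc intro!: mult_left_mono)

lemma gchoose_derivative: "\<exists>d. ((\<lambda>t::real. t gchoose i) has_real_derivative d) (at t)"
proof -
  obtain p where "\<And>x::real. x gchoose i = poly p x"
    using gchoose_eq_poly by metis
  then show ?thesis
    using poly_DERIV[of p t] by (intro exI[of _ "poly (pderiv p) t"]) simp
qed

lemma tendsto_choose_mult_exp:
  assumes "a > 0"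
  shows "(\<lambda>n. real (n choose i) * exp (- (a * real n))) \<longlonglongrightarrow> 0"
proof (rule Lim_null_comparison)
  have "filterlim (\<lambda>n. a * real n) at_top sequentially"
    by (rule filterlim_tendsto_pos_mult_at_top[OF tendsto_const assms filterlim_real_sequentially])
  from filterlim_compose[OF tendsto_power_div_exp_0 this]
  have "(\<lambda>n. (a * real n) ^ i / exp (a * real n)) \<longlonglongrightarrow> 0" .
  from tendsto_mult_right_zero[OF this]
  show "(\<lambda>n. (1 / a ^ i) * ((a * real n) ^ i / exp (a * real n))) \<longlonglongrightarrow> 0" .
  have "real (n choose i) * exp (- (a * real n)) \<le> (1 / a ^ i) * ((a * real n) ^ i / exp (a * real n))" for n
  proof -
    have "n choose i \<le> n ^ i"
      by (cases "i \<le> n") (auto intro: binomial_le_pow simp: binomial_eq_0)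
    then have "real (n choose i) \<le> real n ^ i"
      by (metis of_nat_le_iff of_nat_power)
    then show ?thesis
      using assms by (simp add: exp_minus divide_inverse power_mult_distrib mult_right_mono flip: mult.assoc)
  qed
  then show "\<forall>\<^sub>F n in sequentially. norm (real (n choose i) * exp (- (a * real n)))
      \<le> (1 / a ^ i) * ((a * real n) ^ i / exp (a * real n))"
    by simp
qed

section \<open>Polynomial orbits of m-isometric semigroups\<close>

locale m_isometric_C0_semigroup =
  fixes T :: "real \<Rightarrow> 'a::complex_hilbert_space \<Rightarrow> 'a" and m
  assumes m_isometric_semigroup: "m_isometric_semigroup m T"
begin

text \<open>The coefficients of the orbit polynomial in the Newton basis \<open>t gchoose i\<close>,
  read off at integer times.\<close>

definition coeff :: "nat \<Rightarrow> 'a \<Rightarrow> real" where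
  "coeff i x = (fdiff ^^ i) (\<lambda>k. (norm (T (real k) x))\<^sup>2) 0"

lemma C0: "C0_semigroup T"
  using m_isometric_semigroup by (simp add: m_isometric_semigroup_def)

lemma T_bounded_linear: "t \<ge> 0 \<Longrightarrow> bounded_linear (T t)"
  using C0 by (simp add: C0_semigroup_def bounded_operator_def)

text \<open>The m-isometry of T h at the vector T s x is the vanishing of the m-th difference at s
  with step h.\<close>

lemma norm_orbit_polynomial:
  assumes "t \<ge> 0"
  shows "(norm (T t x))\<^sup>2 = (\<Sum>i<m. coeff i x * (t gchoose i))"
  unfolding coeff_def
proof (rule continuous_fdiff_zero_imp_polynomial[OF _ _ assms])
  show "continuous_on {0..} (\<lambda>t. (norm (T t x))\<^sup>2)"
    using C0 by (intro continuous_intros) (simp add: C0_semigroup_def)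
  fix s h :: real
  assume "s \<ge> 0" "h \<ge> 0"
  have "T (h + (s + real k * h)) x = T h (T (s + real k * h) x)" for k
    using C0 \<open>s \<ge> 0\<close> \<open>h \<ge> 0\<close> by (simp add: C0_semigroup_def)
  then have "(T h ^^ k) (T s x) = T (s + real k * h) x" for k
    by (induction k) (simp_all add: algebra_simps)
  then show "(fdiff ^^ m) (\<lambda>k. (norm (T (s + real k * h) x))\<^sup>2) 0 = 0"
    using m_isometric_semigroup \<open>h \<ge> 0\<close>
    by (simp add: m_isometric_semigroup_def m_isometric_def fdiff_funpow flip: \<open>\<And>k. (T h ^^ k) (T s x) = T (s + real k * h) x\<close>)
qed

text \<open>For i < m only T 0, ..., T (m - 1) enter, so finitely many operator norms give a bound
  uniform in x.\<close>

lemma coeff_bound: "\<exists>K\<ge>0. \<forall>x. \<forall>i<m. \<bar>coeff i x\<bar> \<le> K * (norm x)\<^sup>2"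
proof -
  define b where "b i = (\<Sum>k\<le>i. real (i choose k) * (onorm (T (real k)))\<^sup>2)" for i
  have b: "b i \<ge> 0" for i
    by (auto simp: b_def intro!: sum_nonneg)
  have "\<bar>coeff i x\<bar> \<le> (\<Sum>i<m. b i) * (norm x)\<^sup>2" if "i < m" for i x
  proof -
    have "\<bar>coeff i x\<bar> \<le> b i * (norm x)\<^sup>2"
      unfolding coeff_def b_def
    proof (rule fdiff_bound)
      fix k
      show "\<bar>(norm (T (real k) x))\<^sup>2\<bar> \<le> (onorm (T (real k)))\<^sup>2 * (norm x)\<^sup>2"
        using onorm[OF T_bounded_linear, of "real k" x]
        by (simp add: power_mono flip: power_mult_distrib)
    qed
    also have "b i \<le> (\<Sum>i<m. b i)"
      using that b by (intro member_le_sum) auto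
    finally show ?thesis
      by (simp add: mult_right_mono)
  qed
  moreover have "(\<Sum>i<m. b i) \<ge> 0"
    using b by (intro sum_nonneg) auto
  ultimately show ?thesis by blast
qed

lemma norm_orbit_bound:
  "\<exists>K\<ge>0. \<forall>t\<ge>0. \<forall>x. (norm (T t x))\<^sup>2 \<le> K * (\<Sum>i<m. \<bar>t gchoose i\<bar>) * (norm x)\<^sup>2"
proof -
  obtain K where K: "K \<ge> 0" "\<And>x i. i < m \<Longrightarrow> \<bar>coeff i x\<bar> \<le> K * (norm x)\<^sup>2"
    using coeff_bound by blast
  have "(norm (T t x))\<^sup>2 \<le> K * (\<Sum>i<m. \<bar>t gchoose i\<bar>) * (norm x)\<^sup>2" if "t \<ge> 0" for t x
  proof -
    have "coeff i x * (t gchoose i) \<le> K * (norm x)\<^sup>2 * \<bar>t gchoose i\<bar>" if "i < m" for i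
      using K(2)[OF that, of x] abs_ge_self[of "coeff i x * (t gchoose i)"]
      by (simp add: abs_mult) (meson abs_ge_zero mult_right_mono order_trans)
    then have "(\<Sum>i<m. coeff i x * (t gchoose i)) \<le> (\<Sum>i<m. K * (norm x)\<^sup>2 * \<bar>t gchoose i\<bar>)"
      by (intro sum_mono) auto
    then show ?thesis
      unfolding norm_orbit_polynomial[OF that] sum_distrib_left[symmetric] by (simp only: mult_ac)
  qed
  with K(1) show ?thesis by blast
qed

lemma locally_bounded: "\<exists>M\<ge>0. \<forall>t\<in>{0..N}. \<forall>x. norm (T t x) \<le> M * norm x"
proof -
  obtain K where K: "K \<ge> 0"
    "\<And>t x. t \<ge> 0 \<Longrightarrow> (norm (T t x))\<^sup>2 \<le> K * (\<Sum>i<m. \<bar>t gchoose i\<bar>) * (norm x)\<^sup>2"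
    using norm_orbit_bound by blast
  have "continuous_on {0..N} (\<lambda>t. t gchoose i)" for i
    using gchoose_derivative DERIV_isCont by (metis continuous_at_imp_continuous_on)
  then have "continuous_on {0..N} (\<lambda>t. \<Sum>i<m. \<bar>t gchoose i\<bar>)"
    by (intro continuous_intros)
  then have "bounded ((\<lambda>t. \<Sum>i<m. \<bar>t gchoose i\<bar>) ` {0..N})"
    by (intro compact_imp_bounded compact_continuous_image) auto
  then obtain B where B: "\<And>t. t \<in> {0..N} \<Longrightarrow> (\<Sum>i<m. \<bar>t gchoose i\<bar>) \<le> B" "B > 0"
    unfolding bounded_pos by (metis abs_le_D1 imageI real_norm_def)
  have "norm (T t x) \<le> sqrt (K * B) * norm x" if "t \<in> {0..N}" for t x
  proof (rule power2_le_imp_le)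
    have "(norm (T t x))\<^sup>2 \<le> K * (\<Sum>i<m. \<bar>t gchoose i\<bar>) * (norm x)\<^sup>2"
      using K(2) that by simp
    also have "\<dots> \<le> K * B * (norm x)\<^sup>2"
      using K(1) B(1)[OF that] by (intro mult_right_mono mult_left_mono) auto
    finally show "(norm (T t x))\<^sup>2 \<le> (sqrt (K * B) * norm x)\<^sup>2"
      using K(1) B(2) by (simp add: power_mult_distrib)
  qed (use K(1) B(2) in simp)
  then show ?thesis
    using K(1) B(2) by (intro exI[of _ "sqrt (K * B)"]) auto
qed

text \<open>The exponential beats polynomial growth. N is taken to be an integer, where
  \<open>gchoose\<close> is a binomial coefficient and hence nonnegative.\<close>

lemma exponentially_dominated:
  assumes "\<mu> > 0"
  shows "\<exists>N\<ge>0. \<forall>x. norm (rescaled (- \<mu>) T N x) \<le> 1 / 2 * norm x"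
proof -
  obtain K where K: "K \<ge> 0"
    "\<And>t x. t \<ge> 0 \<Longrightarrow> (norm (T t x))\<^sup>2 \<le> K * (\<Sum>i<m. \<bar>t gchoose i\<bar>) * (norm x)\<^sup>2"
    using norm_orbit_bound by blast
  \<comment> \<open>The factor 2 in the exponent and the threshold 1 / 4 come from working with
    squared norms.\<close>
  have "(\<lambda>n. K * (\<Sum>i<m. real (n choose i) * exp (- ((2 * \<mu>) * real n)))) \<longlonglongrightarrow> K * (\<Sum>i<m. 0)"
    using assms by (intro tendsto_intros tendsto_choose_mult_exp) auto
  then have "\<forall>\<^sub>F n in sequentially. K * (\<Sum>i<m. real (n choose i) * exp (- ((2 * \<mu>) * real n))) < 1 / 4"
    by (intro order_tendstoD) auto
  then obtain n where n: "K * (\<Sum>i<m. real (n choose i) * exp (- ((2 * \<mu>) * real n))) < 1 / 4"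
    by (auto simp: eventually_sequentially)
  have "norm (rescaled (- \<mu>) T (real n) x) \<le> 1 / 2 * norm x" for x
  proof (rule power2_le_imp_le)
    have "(norm (rescaled (- \<mu>) T (real n) x))\<^sup>2 = exp (- ((2 * \<mu>) * real n)) * (norm (T (real n) x))\<^sup>2"
      by (simp add: rescaled_def power_mult_distrib exp_double[symmetric] mult.assoc)
    also have "\<dots> \<le> exp (- ((2 * \<mu>) * real n)) * (K * (\<Sum>i<m. \<bar>real n gchoose i\<bar>) * (norm x)\<^sup>2)"
      using K(2) by (intro mult_left_mono) auto
    also have "\<dots> = K * (\<Sum>i<m. real (n choose i) * exp (- ((2 * \<mu>) * real n))) * (norm x)\<^sup>2"
      by (simp add: binomial_gbinomial[symmetric] sum_distrib_right[symmetric] mult_ac)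
    also have "\<dots> \<le> 1 / 4 * (norm x)\<^sup>2"
      using n by (intro mult_right_mono) auto
    finally show "(norm (rescaled (- \<mu>) T (real n) x))\<^sup>2 \<le> (1 / 2 * norm x)\<^sup>2"
      by (simp add: power2_eq_square)
  qed simp
  then show ?thesis
    by (intro exI[of _ "real n"]) auto
qed

lemma semigroup_generator:
  assumes "is_generator T D A" "linear_operator D A"
  shows "semigroup_generator T D A"
  using C0 locally_bounded assms by unfold_locales

text \<open>For \<open>y\<close> in the domain, \<open>2 Re \<langle>A y, y\<rangle>\<close> is the derivative at \<open>0\<close> of the polynomial
  \<open>\<parallel>T t y\<parallel>\<^sup>2\<close>, whose coefficients are bounded quadratic forms in \<open>y\<close>.\<close>

lemma numerical_bound_exists:
  assumes "is_generator T D A" "linear_operator D A"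
  shows "\<exists>w\<ge>0. numerical_bound w D A"
proof -
  interpret semigroup_generator T D A
    using assms by (rule semigroup_generator)
  obtain K where K: "K \<ge> 0" "\<And>x i. i < m \<Longrightarrow> \<bar>coeff i x\<bar> \<le> K * (norm x)\<^sup>2"
    using coeff_bound by blast
  have "\<exists>d. \<forall>i. ((\<lambda>t::real. t gchoose i) has_real_derivative d i) (at 0)"
    by (intro choice allI gchoose_derivative)
  then obtain d where d: "\<And>i. ((\<lambda>t::real. t gchoose i) has_real_derivative d i) (at 0)"
    by blast
  define w where "w = K * (\<Sum>i<m. \<bar>d i\<bar>)"
  have w: "w \<ge> 0"
    using K(1) by (simp add: w_def sum_nonneg)
  have "Re (cinner (A y) y) \<le> w * (norm y)\<^sup>2" if "y \<in> D" for y
  proof -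
    have "((\<lambda>t. \<Sum>i<m. coeff i y * (t gchoose i)) has_real_derivative (\<Sum>i<m. coeff i y * d i)) (at 0 within {0..})"
      by (intro DERIV_sum DERIV_cmult DERIV_subset[OF d]) auto
    then have "((\<lambda>t. (norm (T t y))\<^sup>2) has_real_derivative (\<Sum>i<m. coeff i y * d i)) (at 0 within {0..})"
      by (rule has_field_derivative_transform_within[where d=1]) (auto simp: norm_orbit_polynomial)
    moreover have "((\<lambda>t. (norm (T t y))\<^sup>2) has_real_derivative 2 * Re (cinner (A y) y)) (at 0 within {0..})"
      using norm_orbit_derivative[OF that order_refl] by simp
    \<comment> \<open>Derivatives within {0..} are unique even at the endpoint 0, because the filter
      there is the nontrivial \<open>at_right 0\<close>.\<close>
    ultimately have "2 * Re (cinner (A y) y) = (\<Sum>i<m. coeff i y * d i)"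
      unfolding has_real_derivative_iff_has_vector_derivative
      by (intro vector_derivative_unique_within[of 0 "{0..}"]) (simp_all add: at_zero_within_nonneg)
    also have "\<dots> \<le> (\<Sum>i<m. K * (norm y)\<^sup>2 * \<bar>d i\<bar>)"
    proof (rule sum_mono)
      fix i
      assume "i \<in> {..<m}"
      then show "coeff i y * d i \<le> K * (norm y)\<^sup>2 * \<bar>d i\<bar>"
        using mult_right_mono[OF K(2)[of i y] abs_ge_zero[of "d i"]] abs_ge_self[of "coeff i y * d i"]
        by (simp add: abs_mult)
    qed
    also have "\<dots> = w * (norm y)\<^sup>2"
      unfolding w_def sum_distrib_left[symmetric] by (simp only: mult_ac)
    \<comment> \<open>The left end of the chain is 2 Re <A y, y>; doubling the bound lets the factor
      cancel.\<close>
    also have "\<dots> \<le> 2 * (w * (norm y)\<^sup>2)"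
      using w by simp
    finally show ?thesis by simp
  qed
  then show ?thesis
    using w by (auto simp: numerical_bound_def)
qed

text \<open>\<mu> - A is minus the generator of the semigroup rescaled by -\<mu>, which at some time
  N has norm at most 1 / 2.\<close>

lemma resolvent_exists:
  assumes "is_generator T D A" "linear_operator D A" "\<mu> > 0"
  shows "invertible_operator D (\<lambda>y. \<mu> *\<^sub>R y - A y)"
proof -
  interpret S: semigroup_generator "rescaled (- \<mu>) T" D "\<lambda>y. A y + (- \<mu>) *\<^sub>R y"
    using semigroup_generator[OF assms(1,2)] by (rule semigroup_generator.rescaled_semigroup_generator)
  obtain N where "N \<ge> 0" "\<And>x. norm (rescaled (- \<mu>) T N x) \<le> 1 / 2 * norm x"
    using exponentially_dominated[OF \<open>\<mu> > 0\<close>] by blast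
  from S.invertible_generator[OF this] show ?thesis
    by (simp add: algebra_simps)
qed

lemma generation_conditions:
  assumes "is_generator T D A" "linear_operator D A"
  shows "generation_conditions m D A"
proof -
  interpret semigroup_generator T D A
    using assms by (rule semigroup_generator)
  obtain w where w: "w \<ge> 0" "numerical_bound w D A"
    using numerical_bound_exists[OF assms] by blast
  \<comment> \<open>One inverse serves twice: it gives the surjectivity in (iii) and the closedness
    in (i).\<close>
  have inv: "invertible_operator D (\<lambda>y. (w + 1) *\<^sub>R y - A y)"
    using w(1) by (intro resolvent_exists assms) simp
  then have "(\<lambda>y. (w + 1) *\<^sub>R y - A y) ` D = UNIV"
    unfolding invertible_operator_def by (auto simp: image_iff) metis
  moreover have "w + 1 > w" by simp
  moreover have "m_skew_symmetric m D A"
    using m_isometric_semigroup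
    by (intro m_isometric_imp_m_skew_symmetric) (simp add: m_isometric_semigroup_def)
  ultimately show ?thesis
    unfolding generation_conditions_def densely_defined_def
    using w invertible_operator_imp_closed[OF inv] domain_dense by blast
qed

end

lemma generation_conditions_imp_generator:
  assumes "generation_conditions m D A" "linear_operator D A" "m \<ge> 1"
  shows "\<exists>T. m_isometric_semigroup m T \<and> is_generator T D A"
proof -
  obtain w \<mu> where "densely_defined D" "numerical_bound w D A" "\<mu> > w"
    "(\<lambda>y. \<mu> *\<^sub>R y - A y) ` D = UNIV" and skew: "m_skew_symmetric m D A"
    using assms(1) unfolding generation_conditions_def by blast
  then obtain T where "semigroup_generator T D A"
    using quasidissipative_generates[OF assms(2)] by blast
  then interpret semigroup_generator T D A .
  show ?thesis
    using C0 gen m_skew_symmetric_imp_m_isometric[OF skew assms(3)]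
    by (auto simp: m_isometric_semigroup_def)
qed

theorem theorem1p1:
  fixes m :: nat
    and D :: "'a::complex_hilbert_space set"
    and A :: "'a \<Rightarrow> 'a"
  assumes "m \<ge> 1"
    and "linear_operator D A"
  shows "((\<exists>T. m_isometric_semigroup m T \<and> is_generator T D A) \<longleftrightarrow> generation_conditions m D A) \<and>
    (generation_conditions m D A \<longrightarrow>
      (\<forall>T w. m_isometric_semigroup m T \<and> is_generator T D A \<and> w \<ge> 0 \<longrightarrow>
        (numerical_bound w D A \<longleftrightarrow> quasicontractive w T)) \<and>
      (\<forall>\<mu>>0. invertible_operator D (\<lambda>y. \<mu> *\<^sub>R y - A y)))"
proof -
  have "m_isometric_C0_semigroup T m" if "m_isometric_semigroup m T" for T :: "real \<Rightarrow> 'a \<Rightarrow> 'a"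
    using that by unfold_locales
  note misom = m_isometric_C0_semigroup.generation_conditions[OF this]
    m_isometric_C0_semigroup.resolvent_exists[OF this]
    m_isometric_C0_semigroup.semigroup_generator[OF this, THEN semigroup_generator.numerical_bound_iff_quasicontractive]
  then show ?thesis
    using generation_conditions_imp_generator assms by meson
qed

end
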